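(* The topological full group $[[T]]$ of the substitution subshift $T:\Omega\to\Omega$ is generated by the four transformations $T$, $\delta_{[.b]}$, $\delta_{[.d]}$, and $\delta_{[.acacac]}$.
   Context: Let $\mathcal{A}=\{a,b,c,d\}$ and let $\sigma$ be the Lysenok substitution over $\mathcal{A}$: $\sigma(a)=aca$, $\sigma(b)=d$, $\sigma(c)=b$, $\sigma(d)=c$, acting on finite and on infinite words letter by letter with concatenation. Let $\xi=\xi_1\xi_2\xi_3\dots\in\mathcal{A}^{\mathbb{N}}$ be the unique infinite word fixed by $\sigma$ ($\xi=acabacad\dots$). Let $\Omega$ be the set of all bi-infinite sequences $\omega=\dots\omega_{-2}\omega_{-1}\omega_0.\omega_1\omega_2\dots$ over $\mathcal{A}$ such that every finite subword $\omega_l\omega_{l+1}\dots\omega_m$ occurs somewhere in $\xi$, with the topology induced by the product topology on $\mathcal{A}^{\mathbb{Z}}$. Let $T:\Omega\to\Omega$ be the shift $T(\omega)=\dots\omega_{-1}\omega_0\omega_1.\omega_2\omega_3\dots$, i.e. $(T\omega)_i=\omega_{i+1}$. (It is known that $\Omega$ is a Cantor set and $T$ is a minimal homeomorphism.) The topological full group $[[T]]$ is the group (under composition) of all homeomorphisms $f:\Omega\to\Omega$ for which there is a continuous function $\nu:\Omega\to\mathbb{Z}$ with $f(x)=T^{\nu(x)}(x)$ for all $x\in\Omega$. For finite words $u,w$ over $\mathcal{A}$ of lengths $M,N\ge0$, the cylinder $[u.w]$ is the set of all $\omega\in\Omega$ with $\omega_{-M+1}\dots\omega_{-1}\omega_0=u$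 and $\omega_1\omega_2\dots\omega_N=w$; $[.w]$ denotes the case of empty $u$. For a clopen set $U\subset\Omega$ with $U\cap T(U)=\emptyset$, $\delta_U:\Omega\to\Omega$ is defined by $\delta_U(x)=T(x)$ if $x\in U$, $\delta_U(x)=T^{-1}(x)$ if $x\in T(U)$, and $\delta_U(x)=x$ otherwise. It is an element of $[[T]]$. Cylinders $[u.w]$ with $u,w$ not both empty are clopen and disjoint from their image under $T$ (there are no double letters in $\xi$), so $\delta_{[u.w]}$ is well defined for them. *)

theory Defs
  imports "HOL-Analysis.Analysis" "HOL-Algebra.Bij" "HOL-Algebra.Generated_Groups" "HOL-Library.Stream"
begin

datatype letter = LA | LB | LC | LD

fun lysenok :: "letter \<Rightarrow> letter list" where
  "lysenok LA = [LA, LC, LA]"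
| "lysenok LB = [LD]"
| "lysenok LC = [LB]"
| "lysenok LD = [LC]"

definition lysenok_word :: "letter list \<Rightarrow> letter list" where
  "lysenok_word w = concat (map lysenok w)"

definition lysenok_stream :: "letter stream \<Rightarrow> letter stream" where
  "lysenok_stream s = flat (smap lysenok s)"

definition xi :: "letter stream" where
  "xi = (THE s. lysenok_stream s = s)"

definition occurs_in_xi :: "letter list \<Rightarrow> bool" where
  "occurs_in_xi w \<longleftrightarrow> (\<exists>n. stake (length w) (sdrop n xi) = w)"

definition Omega :: "(int \<Rightarrow> letter) set" where
  "Omega = {\<omega>. \<forall>l m. l \<le> m \<longrightarrow> occurs_in_xi (map \<omega> [l..m])}"

definition Omega_top :: "(int \<Rightarrow> letter) topology" where
  "Omega_top = subtopology (product_topology (\<lambda>_. discrete_topology UNIV) UNIV) Omega"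

text \<open>Self-maps of \<^term>\<open>Omega\<close> are represented as extensional functions (equal to
  \<^term>\<open>undefined\<close> outside \<^term>\<open>Omega\<close>), as in \<^term>\<open>BijGroup Omega\<close>; the
  composition of that group is composition of maps restricted to \<^term>\<open>Omega\<close>.\<close>

definition Shift :: "(int \<Rightarrow> letter) \<Rightarrow> (int \<Rightarrow> letter)" where
  "Shift = (\<lambda>\<omega>\<in>Omega. (\<lambda>i. \<omega> (i + 1)))"

text \<open>Here \<open>T\<close> is meant to be an extensional self-homeomorphism of \<open>X\<close>; its integer powers
  are taken in the group of all bijections of the underlying set of \<open>X\<close>.\<close>

definition full_group_carrier :: "'a topology \<Rightarrow> ('a \<Rightarrow> 'a) \<Rightarrow> ('a \<Rightarrow> 'a) set" where
  "full_group_carrier X T =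
     {f \<in> Bij (topspace X). homeomorphic_map X X f \<and>
        (\<exists>nu :: 'a \<Rightarrow> int. continuous_map X (discrete_topology UNIV) nu \<and>
           (\<forall>x \<in> topspace X. f x = (T [^]\<^bsub>BijGroup (topspace X)\<^esub> nu x) x))}"

definition topological_full_group :: "'a topology \<Rightarrow> ('a \<Rightarrow> 'a) \<Rightarrow> ('a \<Rightarrow> 'a) monoid" where
  "topological_full_group X T = BijGroup (topspace X) \<lparr> carrier := full_group_carrier X T \<rparr>"

text \<open>In \<open>cylinder u w\<close>, the word \<open>u\<close> ends at position 0 and \<open>w\<close> starts at position 1.\<close>

definition cylinder :: "letter list \<Rightarrow> letter list \<Rightarrow> (int \<Rightarrow> letter) set" where
  "cylinder u w = {\<omega> \<in> Omega. map \<omega> [1 - int (length u)..0] = u \<and>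
                              map \<omega> [1..int (length w)] = w}"

text \<open>Meant for clopen \<open>U \<subseteq> Omega\<close> disjoint from \<^term>\<open>Shift ` U\<close>; on other \<open>U\<close> the value is
  not meaningful.\<close>

definition delta :: "(int \<Rightarrow> letter) set \<Rightarrow> (int \<Rightarrow> letter) \<Rightarrow> (int \<Rightarrow> letter)" where
  "delta U = (\<lambda>x\<in>Omega. if x \<in> U then Shift x
                        else if x \<in> Shift ` U then inv_into Omega Shift x
                        else x)"

lemma lysenok_nonempty: "lysenok x \<noteq> []"
  by (cases x) auto

lemma lysenok_stream_SCons: "lysenok_stream (x ## s) = lysenok x @- lysenok_stream s"
  unfolding lysenok_stream_def by (simp add: lysenok_nonempty)

lemma lysenok_stream_shift: "lysenok_stream (w @- s) = lysenok_word w @- lysenok_stream s"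
  by (induction w) (auto simp: lysenok_stream_SCons lysenok_word_def)

lemma lysenok_stream_fixed_shd: 
  assumes "lysenok_stream s = s" shows "shd s = LA"
proof -
  obtain x t where s: "s = x ## t" by (cases s)
  have "lysenok x @- lysenok_stream t = x ## t"
    using assms unfolding s lysenok_stream_SCons .
  then show ?thesis by (cases x) (auto simp: s)
qed

definition xi_prefix :: "nat \<Rightarrow> letter list" where
  "xi_prefix n = (lysenok_word ^^ n) [LA]"

lemma xi_prefix_Suc: "xi_prefix (Suc n) = lysenok_word (xi_prefix n)"
  by (simp add: xi_prefix_def)

lemma lysenok_word_append: "lysenok_word (u @ w) = lysenok_word u @ lysenok_word w"
  by (simp add: lysenok_word_def)

lemma xi_prefix_extend: "\<exists>w. w \<noteq> [] \<and> xi_prefix (Suc n) = xi_prefix n @ w"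
proof (induction n)
  case 0
  show ?case by (simp add: xi_prefix_def lysenok_word_def)
next
  case (Suc n)
  then obtain w where w: "w \<noteq> []" "xi_prefix (Suc n) = xi_prefix n @ w" by blast
  have "lysenok_word w \<noteq> []"
    using w(1) by (cases w) (auto simp: lysenok_word_def lysenok_nonempty)
  moreover have "xi_prefix (Suc (Suc n)) = xi_prefix (Suc n) @ lysenok_word w"
    unfolding xi_prefix_Suc[of "Suc n"] using w(2) lysenok_word_append[of "xi_prefix n" w]
    by (simp only: xi_prefix_Suc[of n])
  ultimately show ?case by blast
qed

lemma length_xi_prefix: "n < length (xi_prefix n)"
proof (induction n)
  case 0
  show ?case by (simp add: xi_prefix_def)
next
  case (Suc n)
  obtain w where "w \<noteq> []" "xi_prefix (Suc n) = xi_prefix n @ w"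
    using xi_prefix_extend by blast
  then show ?case using Suc by (cases w) auto
qed

lemma xi_prefix_mono: "m \<le> n \<Longrightarrow> \<exists>w. xi_prefix n = xi_prefix m @ w"
proof (induction n rule: dec_induct)
  case base
  show ?case by simp
next
  case (step n)
  then show ?case using xi_prefix_extend[of n] by auto
qed

lemma lysenok_stream_fixed_prefix:
  assumes "lysenok_stream s = s" shows "\<exists>t. s = xi_prefix n @- t"
proof (induction n)
  case 0
  obtain x t where s: "s = x ## t" by (cases s)
  then have "x = LA" using lysenok_stream_fixed_shd[OF assms] by simp
  then have "s = xi_prefix 0 @- t" by (simp add: s xi_prefix_def)
  then show ?case by (rule exI)
next
  case (Suc n)
  then obtain t where t: "s = xi_prefix n @- t" by blast
  have "lysenok_stream s = xi_prefix (Suc n) @- lysenok_stream t"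
    unfolding t lysenok_stream_shift xi_prefix_Suc ..
  then have "s = xi_prefix (Suc n) @- lysenok_stream t"
    unfolding assms .
  then show ?case by (rule exI)
qed

lemma stream_eq_of_common_prefixes:
  assumes "\<And>n. \<exists>t. s = xi_prefix n @- t" "\<And>n. \<exists>t. s' = xi_prefix n @- t"
  shows "s = s'"
proof -
  have "s !! n = s' !! n" for n
  proof -
    obtain t t' where "s = xi_prefix n @- t" "s' = xi_prefix n @- t'"
      using assms by blast
    then show ?thesis using length_xi_prefix[of n] by (simp add: shift_snth_less)
  qed
  then show ?thesis
    using smap_alt[of id s s'] by (simp add: stream.map_id)
qed

lemma lysenok_stream_ex1_fixed: "\<exists>!s. lysenok_stream s = s"
proof (rule ex_ex1I)
  define s where "s = smap (\<lambda>i. xi_prefix i ! i) nats"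
  have pre: "\<exists>t. s = xi_prefix n @- t" for n
  proof -
    have "stake (length (xi_prefix n)) s = xi_prefix n"
    proof (rule nth_equalityI)
      fix i assume "i < length (stake (length (xi_prefix n)) s)"
      then have i: "i < length (xi_prefix n)" by simp
      have "xi_prefix i ! i = xi_prefix n ! i"
      proof (cases "i \<le> n")
        case True
        then obtain w where "xi_prefix n = xi_prefix i @ w" using xi_prefix_mono by blast
        then show ?thesis using length_xi_prefix[of i] by (simp add: nth_append)
      next
        case False
        then obtain w where "xi_prefix i = xi_prefix n @ w"
          using xi_prefix_mono[of n i] by auto
        then show ?thesis using i by (simp add: nth_append)
      qed
      then show "stake (length (xi_prefix n)) s ! i = xi_prefix n ! i"
        using i by (simp add: s_def)
    qed simp
    then have "xi_prefix n @- sdrop (length (xi_prefix n)) s = s"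
      using stake_sdrop[of "length (xi_prefix n)" s] by (rule subst)
    then have "s = xi_prefix n @- sdrop (length (xi_prefix n)) s" by (rule sym)
    then show ?thesis by (rule exI)
  qed
  have pre': "\<exists>t. lysenok_stream s = xi_prefix n @- t" for n
  proof -
    obtain t where "s = xi_prefix n @- t" using pre by blast
    then have "lysenok_stream s = xi_prefix (Suc n) @- lysenok_stream t"
      by (simp add: lysenok_stream_shift xi_prefix_Suc)
    moreover obtain w where "xi_prefix (Suc n) = xi_prefix n @ w"
      using xi_prefix_extend by blast
    ultimately show ?thesis by auto
  qed
  have "lysenok_stream s = s"
    by (rule stream_eq_of_common_prefixes[OF pre' pre])
  then show "\<exists>s. lysenok_stream s = s" ..
next
  fix s s' assume s: "lysenok_stream s = s" "lysenok_stream s' = s'"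
  show "s = s'"
    using stream_eq_of_common_prefixes[OF lysenok_stream_fixed_prefix[OF s(1)]
      lysenok_stream_fixed_prefix[OF s(2)]] .
qed

lemma lysenok_stream_xi: "lysenok_stream xi = xi"
  unfolding xi_def by (rule theI'[OF lysenok_stream_ex1_fixed])

lemma Omega_translate:
  assumes "\<omega> \<in> Omega" shows "(\<lambda>i. \<omega> (i + k)) \<in> Omega"
proof -
  have "map (\<lambda>i. \<omega> (i + k)) [l..m] = map \<omega> [l + k..m + k]" for l m
    by (rule nth_equalityI) (simp_all add: add.commute add.left_commute)
  moreover have "occurs_in_xi (map \<omega> [l + k..m + k])" if "l \<le> m" for l m
    using assms that unfolding Omega_def by simp
  ultimately show ?thesis unfolding Omega_def by simp
qed

lemma topspace_Omega_top: "topspace Omega_top = Omega"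
  by (simp add: Omega_top_def)

lemma Shift_Bij: "Shift \<in> Bij Omega"
proof -
  have "bij_betw Shift Omega Omega"
  proof (rule bij_betw_byWitness[where f' = "\<lambda>\<omega> i. \<omega> (i - 1)"])
    show "Shift ` Omega \<subseteq> Omega"
      using Omega_translate[where k = 1] by (simp add: Shift_def image_subset_iff)
    show "(\<lambda>\<omega> i. \<omega> (i - 1)) ` Omega \<subseteq> Omega"
      using Omega_translate[where k = "-1"] by (simp add: image_subset_iff)
    show "\<forall>\<omega>\<in>Omega. Shift (\<lambda>i. \<omega> (i - 1)) = \<omega>"
      using Omega_translate[where k = "-1"] by (simp add: Shift_def)
  qed (simp add: Shift_def)
  then show ?thesis by (simp add: Bij_def Shift_def)
qed

end

theory Submission
  imports Defs "HOL-Combinatorics.Permutations"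
begin

text \<open>Words of the subshift are Toeplitz: for every level \<open>n\<close> the positions outside one residue
  class modulo \<open>2 ^ n\<close> (the centers) carry letters that depend only on the distance to that
  class, and the centers carry \<open>b\<close>, \<open>c\<close> or \<open>d\<close>. An element of the full group is determined by
  finite windows, so for large \<open>n\<close>, after a correction by a power of the shift and a permutation near
  the cuts half way between centers, it permutes each block around a center in a way depending only
  on the letter there. Hence the group is generated by the shift and the transpositions
  \<open>\<delta>\<close> of the sets \<open>marked n x\<close> of centers of level \<open>n\<close> carrying \<open>x\<close>. Up to conjugation by the shift,
  the three given \<open>\<delta>\<close> are those of level 2. If all three are available at level \<open>n\<close>, then commutators
  give 3-cycles on smaller sets, and the decomposition of \<open>marked (n + 1) (toep (n + 1))\<close>
  into sets of the next level yields the only transposition missing at level \<open>n + 1\<close>.\<close>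


text \<open>The obstacle is parity. Commutators only yield even permutations of levels, so they
  never isolate a transposition, and the passage from level \<open>n\<close> to \<open>n + 1\<close>
  breaks exactly the transposition for the letter \<open>toep n\<close>: every center that is lost
  carries this letter. The way out is a set that enters twice. With \<open>m = n + 1\<close> and
  \<open>y = toep m\<close>, the set \<open>marked m y\<close> is the disjoint union of a set
  \<open>u\<close>, the translate of \<open>u\<close> by \<open>2 ^ m\<close>, and two translated
  sets of level \<open>m + 1\<close>, one for each of the other letters. The swap over
  \<open>u\<close> times the swap over its translate is a product of 3-cycles, one of the remaining
  two swaps is known, and the last one can be solved for. A single power of the shift is enough in
  the reduction to blocks because words look alike away from the centers, so the net number of
  points carried across a cut is the same at all cuts.\<close>

definition translate :: "int \<Rightarrow> (int \<Rightarrow> letter) \<Rightarrow> int \<Rightarrow> letter" where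
  "translate k \<omega> = (\<lambda>i. \<omega> (i + k))"

lemma translate_apply [simp]: "translate k \<omega> i = \<omega> (i + k)"
  by (simp add: translate_def)

lemma translate_0 [simp]: "translate 0 \<omega> = \<omega>"
  by (simp add: translate_def)

lemma translate_translate [simp]: "translate j (translate k \<omega>) = translate (j + k) \<omega>"
  by (simp add: translate_def add.assoc)

lemma translate_in_Omega [simp]: "\<omega> \<in> Omega \<Longrightarrow> translate k \<omega> \<in> Omega"
  unfolding translate_def by (rule Omega_translate)

lemma translate_in_Omega_iff [simp]: "translate k \<omega> \<in> Omega \<longleftrightarrow> \<omega> \<in> Omega"
  using translate_in_Omega[of "translate k \<omega>" "- k"] by auto

lemma Shift_eq_translate: "\<omega> \<in> Omega \<Longrightarrow> Shift \<omega> = translate 1 \<omega>"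
  by (simp add: Shift_def translate_def)

section \<open>The Toeplitz structure of the subshift\<close>

text \<open>The letters c, b, d in this order form the cycle of \<open>lysenok\<close>, entered at
  the middle letter of \<open>lysenok LA\<close>. Hence the period 3 from index 1 on, with
  \<open>toep 0\<close> as the exceptional value.\<close>

definition toep :: "nat \<Rightarrow> letter" where
  "toep j = (if j = 0 then LA else if j mod 3 = 1 then LC else if j mod 3 = 2 then LB else LD)"

lemma toep_eq_LA_iff: "toep j = LA \<longleftrightarrow> j = 0"
  by (simp add: toep_def)

lemma toep_Suc_neq: "toep (Suc j) \<noteq> toep j"
  by (auto simp: toep_def mod_Suc split: if_splits)

lemma toep_cases:
  assumes "n > 0" "x \<noteq> LA"
  shows "x = toep n \<or> x = toep (Suc n) \<or> x = toep (Suc (Suc n))"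
  using assms by (cases x) (auto simp: toep_def mod_Suc split: if_splits)

lemma toep_distinct:
  assumes "n > 0"
  shows "toep n \<noteq> toep (Suc n)" "toep n \<noteq> toep (Suc (Suc n))"
    "toep (Suc n) \<noteq> toep (Suc (Suc n))"
  using assms by (auto simp: toep_def mod_Suc split: if_splits)

lemma lysenok_toep: "j > 0 \<Longrightarrow> lysenok (toep j) = [toep (Suc j)]"
  by (auto simp: toep_def mod_Suc split: if_splits)

text \<open>Each pair \<open>a x\<close> becomes \<open>a c a\<close> followed by the image of
  \<open>x\<close>, so indices double. The induction peels off one pair and replaces
  \<open>g\<close> by its shift, which is why \<open>g\<close> is arbitrary.\<close>

lemma lysenok_stream_alternating:
  assumes "\<And>k. z !! (2 * k) = LA" "\<And>k. z !! (2 * k + 1) = toep (g k)" "\<And>k. g k > 0"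
  shows "lysenok_stream z !! (4 * k) = LA \<and> lysenok_stream z !! (4 * k + 1) = LC
       \<and> lysenok_stream z !! (4 * k + 2) = LA
       \<and> lysenok_stream z !! (4 * k + 3) = toep (Suc (g k))"
  using assms
proof (induction k arbitrary: z g)
  case (0 z g)
  have z: "z = shd z ## shd (stl z) ## stl (stl z)" by simp
  have "shd z = LA" "shd (stl z) = toep (g 0)" using "0.prems"(1,2)[of 0] by simp_all
  with z have "z = LA ## toep (g 0) ## stl (stl z)" by simp
  then have "lysenok_stream z = [LA, LC, LA, toep (Suc (g 0))] @- lysenok_stream (stl (stl z))"
    using lysenok_stream_SCons[of LA "toep (g 0) ## stl (stl z)"]
      lysenok_stream_SCons[of "toep (g 0)" "stl (stl z)"] lysenok_toep[OF "0.prems"(3)[of 0]]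
    by simp
  then show ?case by (simp add: numeral_eq_Suc)
next
  case (Suc k z g)
  have z: "z = shd z ## shd (stl z) ## stl (stl z)" by simp
  have "shd z = LA" "shd (stl z) = toep (g 0)" using Suc.prems(1,2)[of 0] by simp_all
  with z have "z = LA ## toep (g 0) ## stl (stl z)" by simp
  then have eq: "lysenok_stream z = [LA, LC, LA, toep (Suc (g 0))] @- lysenok_stream (stl (stl z))"
    using lysenok_stream_SCons[of LA "toep (g 0) ## stl (stl z)"]
      lysenok_stream_SCons[of "toep (g 0)" "stl (stl z)"] lysenok_toep[OF Suc.prems(3)[of 0]]
    by simp
  have shift: "lysenok_stream z !! (4 + m) = lysenok_stream (stl (stl z)) !! m" for m
    unfolding eq by (simp add: numeral_eq_Suc)
  have "stl (stl z) !! (2 * k) = LA" "stl (stl z) !! (2 * k + 1) = toep (g (Suc k))" for k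
    using Suc.prems(1)[of "Suc k"] Suc.prems(2)[of "Suc k"] by simp_all
  from Suc.IH[OF this Suc.prems(3)] show ?case
    using shift[of "4 * k"] shift[of "4 * k + 1"] shift[of "4 * k + 2"] shift[of "4 * k + 3"]
    by (simp add: algebra_simps)
qed

text \<open>The stream of these letters is fixed by the substitution: doubling a 1-based index
  raises its valuation by one, and \<open>toep\<close> follows \<open>lysenok\<close>. Uniqueness of
  the fixed point identifies it with \<open>xi\<close>.\<close>

lemma xi_snth: "xi !! k = toep (multiplicity 2 (Suc k))"
proof -
  define v :: "nat \<Rightarrow> nat" where "v m = multiplicity 2 m" for m
  have v_odd: "v (Suc (2 * m)) = 0" for m
    unfolding v_def by (rule not_dvd_imp_multiplicity_0) simp
  have v_even: "v (2 * m) = Suc (v m)" if "m > 0" for m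
    unfolding v_def using that by (intro multiplicity_times_same) auto
  define y where "y = smap (\<lambda>k. toep (v (Suc k))) nats"
  have y: "y !! k = toep (v (Suc k))" for k by (simp add: y_def)
  have "y !! (2 * k) = LA" for k
    using v_odd[of k] by (simp add: y toep_def)
  moreover have "y !! (2 * k + 1) = toep (Suc (v (Suc k)))" for k
    using v_even[of "Suc k"] y[of "2 * k + 1"] by (simp del: snth.simps)
  ultimately have *: "lysenok_stream y !! (4 * k) = LA \<and> lysenok_stream y !! (4 * k + 1) = LC
       \<and> lysenok_stream y !! (4 * k + 2) = LA
       \<and> lysenok_stream y !! (4 * k + 3) = toep (Suc (Suc (v (Suc k))))" for k
    by (rule lysenok_stream_alternating) simp_all
  have "lysenok_stream y !! n = y !! n" for n
  proof -
    define k where "k = n div 4"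
    have "n = 4 * k \<or> n = 4 * k + 1 \<or> n = 4 * k + 2 \<or> n = 4 * k + 3"
      unfolding k_def by presburger
    moreover have "y !! (4 * k) = LA" "y !! (4 * k + 2) = LA"
      using v_odd[of "2 * k"] v_odd[of "2 * k + 1"] y[of "4 * k"] y[of "4 * k + 2"]
      by (simp_all add: toep_def del: snth.simps)
    moreover have "y !! (4 * k + 1) = LC"
      using v_even[of "Suc (2 * k)"] v_odd[of k] y[of "4 * k + 1"]
      by (simp add: toep_def del: snth.simps)
    moreover have "y !! (4 * k + 3) = toep (Suc (Suc (v (Suc k))))"
    proof -
      have "Suc (4 * k + 3) = 2 * (2 * Suc k)" by simp
      then show ?thesis
        using v_even[of "2 * Suc k"] v_even[of "Suc k"] y[of "4 * k + 3"]
        by (metis zero_less_Suc nat_0_less_mult_iff zero_less_numeral)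
    qed
    ultimately show ?thesis using *[of k] by auto
  qed
  then have "lysenok_stream y = y"
    using smap_alt[of id "lysenok_stream y" y] by (simp add: stream.map_id)
  then have "xi = y"
    using lysenok_stream_xi lysenok_stream_ex1_fixed by blast
  then show ?thesis using y[of k] by (simp only: v_def)
qed

lemma multiplicity_of_nat_int:
  assumes "m > 0"
  shows "multiplicity 2 (int m) = multiplicity 2 m"
proof (rule multiplicity_eqI)
  have "2 ^ multiplicity 2 m dvd m" by (rule multiplicity_dvd)
  then show "2 ^ multiplicity 2 m dvd int m" by (metis of_nat_dvd_iff of_nat_numeral of_nat_power)
  have "\<not> 2 ^ Suc (multiplicity 2 m) dvd m"
    using assms by (subst power_dvd_iff_le_multiplicity) auto
  then show "\<not> 2 ^ Suc (multiplicity 2 m) dvd int m"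
    by (metis of_nat_dvd_iff of_nat_numeral of_nat_power)
qed

lemma Omega_window:
  assumes "\<omega> \<in> Omega"
  obtains p where "p < l" "\<And>i. l \<le> i \<Longrightarrow> i \<le> m \<Longrightarrow> \<omega> i = toep (multiplicity 2 (i - p))"
proof (cases "l \<le> m")
  case True
  then have "occurs_in_xi (map \<omega> [l..m])" using assms by (simp add: Omega_def)
  then obtain n where n: "stake (length (map \<omega> [l..m])) (sdrop n xi) = map \<omega> [l..m]"
    unfolding occurs_in_xi_def by blast
  \<comment> \<open>\<open>xi !! k\<close> is governed by the valuation of \<open>k + 1\<close>, so
    the origin lies one place before the start of this copy of \<open>xi\<close>.\<close>
  show ?thesis
  proof (rule that[of "l - int n - 1"])
    fix i assume i: "l \<le> i" "i \<le> m"
    define k where "k = nat (i - l)"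
    have k: "k < nat (m + 1 - l)" "l + int k = i" using i by (auto simp: k_def)
    have "stake (length (map \<omega> [l..m])) (sdrop n xi) ! k = xi !! (n + k)"
      using k by (simp add: sdrop_snth)
    moreover have "map \<omega> [l..m] ! k = \<omega> i" using k by (simp add: )
    moreover have "multiplicity 2 (int (Suc (n + k))) = multiplicity 2 (Suc (n + k))"
      by (rule multiplicity_of_nat_int) simp
    moreover have "int (Suc (n + k)) = i - (l - int n - 1)" using k by simp
    ultimately show "\<omega> i = toep (multiplicity 2 (i - (l - int n - 1)))"
      using n xi_snth[of "n + k"] by metis
  qed simp
next
  case False
  then show ?thesis using that[of "l - 1"] by simp
qed

text \<open>\<open>2 ^ j * (2 * t + 1)\<close> runs through the integers of valuation exactly
  \<open>j\<close>. A center behaves like an origin for valuations below \<open>n\<close>; letters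
  at multiples of \<open>2 ^ n\<close> from it are left free.\<close>

definition center :: "nat \<Rightarrow> (int \<Rightarrow> letter) \<Rightarrow> int \<Rightarrow> bool" where
  "center n \<omega> p \<longleftrightarrow> (\<forall>j<n. \<forall>t. \<omega> (p + 2 ^ j * (2 * t + 1)) = toep j)"

lemma center_translate [simp]: "center n (translate k \<omega>) p \<longleftrightarrow> center n \<omega> (p + k)"
  by (simp add: center_def algebra_simps)

lemma center_mono: "center n \<omega> p \<Longrightarrow> m \<le> n \<Longrightarrow> center m \<omega> p"
  by (simp add: center_def)

lemma center_Suc: "center (Suc n) \<omega> p \<longleftrightarrow> center n \<omega> p \<and> (\<forall>t. \<omega> (p + 2 ^ n * (2 * t + 1)) = toep n)"
  by (auto simp: center_def less_Suc_eq)

lemma not_dvd_power2_decomp: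
  fixes d :: int
  assumes "\<not> 2 ^ n dvd d"
  obtains j t where "j < n" "d = 2 ^ j * (2 * t + 1)"
  using assms
proof (induction n arbitrary: d thesis)
  case (Suc n d thesis)
  show ?case
  proof (cases "2 ^ n dvd d")
    case True
    then obtain c where c: "d = 2 ^ n * c" by blast
    with Suc.prems have "odd c" by auto
    then obtain t where "c = 2 * t + 1" by (elim oddE)
    then show ?thesis using Suc.prems(1)[of n t] c by simp
  next
    case False
    then show ?thesis using Suc.IH[of d] Suc.prems(1) by (metis less_Suc_eq)
  qed
qed simp

lemma center_apply:
  assumes "center n \<omega> p" "center n \<omega>' p'" "\<not> 2 ^ n dvd d"
  shows "\<omega> (p + d) = \<omega>' (p' + d)"
  using not_dvd_power2_decomp[OF assms(3)] assms(1,2) unfolding center_def by metis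

lemma center_shift:
  assumes "center n \<omega> p" "2 ^ n dvd q - p"
  shows "center n \<omega> q"
  unfolding center_def
proof (intro allI impI)
  fix j and t :: int assume "j < n"
  from assms(2) obtain c where c: "q = p + 2 ^ n * c" by (auto simp: dvd_def algebra_simps)
  have "q + 2 ^ j * (2 * t + 1) = p + 2 ^ j * (2 * (t + 2 ^ (n - Suc j) * c) + 1)"
  proof -
    have "(2::int) ^ n = 2 ^ j * (2 * 2 ^ (n - Suc j))"
      using \<open>j < n\<close> by (simp flip: power_Suc power_add)
    then show ?thesis unfolding c by (simp add: algebra_simps)
  qed
  then show "\<omega> (q + 2 ^ j * (2 * t + 1)) = toep j"
    using assms(1) \<open>j < n\<close> unfolding center_def by metis
qed

lemma multiplicity_power2_odd: "multiplicity 2 (2 ^ j * (2 * t + 1) :: int) = j"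
  by (rule multiplicity_eqI) (auto simp: mult.assoc)

text \<open>The residue of the starting point of a window depends on the window; the pigeonhole principle
  picks a residue that serves arbitrarily large windows.\<close>

lemma center_exists:
  assumes "\<omega> \<in> Omega"
  obtains p where "center n \<omega> p"
proof -
  have "\<exists>p. \<forall>i. - int R \<le> i \<and> i \<le> int R \<longrightarrow> \<omega> i = toep (multiplicity 2 (i - p))" for R
    using Omega_window[OF assms, of "- int R" "int R"] by metis
  then obtain P where P: "\<And>R i. - int R \<le> i \<Longrightarrow> i \<le> int R \<Longrightarrow> \<omega> i = toep (multiplicity 2 (i - P R))"
    by metis
  have "finite (range (\<lambda>R. P R mod 2 ^ n))"
    by (rule finite_subset[of _ "{0..<2 ^ n}"]) auto
  then obtain R0 where inf: "infinite {R. P R mod 2 ^ n = P R0 mod 2 ^ n}"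
    using pigeonhole_infinite[of UNIV "\<lambda>R. P R mod 2 ^ n"] by auto
  have "center n \<omega> (P R0)"
    unfolding center_def
  proof (intro allI impI)
    fix j and t :: int assume j: "j < n"
    define i where "i = P R0 + 2 ^ j * (2 * t + 1)"
    obtain R where R: "R \<ge> nat \<bar>i\<bar>" "P R mod 2 ^ n = P R0 mod 2 ^ n"
      using inf unfolding infinite_nat_iff_unbounded_le by blast
    then obtain c where c: "P R0 - P R = 2 ^ n * c"
      by (metis mod_eq_dvd_iff dvd_def)
    have "(2::int) ^ n = 2 ^ j * (2 * 2 ^ (n - Suc j))"
      using j by (simp flip: power_Suc power_add)
    then have "i - P R = 2 ^ j * (2 * (t + 2 ^ (n - Suc j) * c) + 1)"
      using c by (simp add: i_def algebra_simps)
    then have "multiplicity 2 (i - P R) = j" by (simp only: multiplicity_power2_odd)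
    then show "\<omega> (P R0 + 2 ^ j * (2 * t + 1)) = toep j"
      using P[of R i] R(1) by (simp add: i_def)
  qed
  then show ?thesis by (rule that)
qed

text \<open>If \<open>p - q\<close> had valuation \<open>j < n\<close>, the position
  \<open>q + 2 ^ (j + 1)\<close> would have valuation \<open>j\<close> relative to \<open>p\<close>
  and \<open>j + 1\<close> relative to \<open>q\<close>, forcing two different letters. The
  additional level at \<open>q\<close> covers \<open>j = n - 1\<close>.\<close>

lemma center_unique:
  assumes p: "center n \<omega> p" and q: "center (Suc n) \<omega> q"
  shows "2 ^ n dvd p - q"
proof (rule ccontr)
  assume "\<not> 2 ^ n dvd p - q"
  then obtain j t where j: "j < n" "p - q = 2 ^ j * (2 * t + 1)"
    by (rule not_dvd_power2_decomp)
  have "\<omega> (p + 2 ^ j * (2 * (- t) + 1)) = toep j"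
    using p j(1) by (simp only: center_def)
  moreover have "p + 2 ^ j * (2 * (- t) + 1) = q + 2 ^ Suc j * (2 * 0 + 1)"
    using j(2) by (simp add: algebra_simps)
  moreover have "\<omega> (q + 2 ^ Suc j * (2 * 0 + 1)) = toep (Suc j)"
    using q j(1) unfolding center_def by blast
  ultimately show False using toep_Suc_neq[of j] by simp
qed

text \<open>Two centers of level \<open>n\<close> are compared through a third one of level
  \<open>n + 1\<close>, since \<open>center_unique\<close> asks for one side a level higher.\<close>

lemma center_iff:
  assumes "\<omega> \<in> Omega" "center n \<omega> p"
  shows "center n \<omega> q \<longleftrightarrow> 2 ^ n dvd q - p"
proof
  assume q: "center n \<omega> q"
  obtain r where r: "center (Suc n) \<omega> r" using center_exists[OF assms(1)] .
  have "2 ^ n dvd (q - r) - (p - r)"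
    using center_unique[OF q r] center_unique[OF assms(2) r] by (rule dvd_diff)
  then show "2 ^ n dvd q - p" by simp
qed (rule center_shift[OF assms(2)])

lemma center_dist:
  assumes "\<omega> \<in> Omega" "center n \<omega> p" "center n \<omega> q" "\<bar>p - q\<bar> < 2 ^ n"
  shows "p = q"
proof (rule ccontr)
  assume "p \<noteq> q"
  have "2 ^ n dvd \<bar>q - p\<bar>" using assms(3) center_iff[OF assms(1,2)] by simp
  then have "2 ^ n \<le> \<bar>q - p\<bar>" using \<open>p \<noteq> q\<close> by (intro zdvd_imp_le) auto
  with assms(4) show False by simp
qed

text \<open>Measured in steps of \<open>2 ^ n\<close> from a center of level \<open>n + 1\<close>,
  even multiples remain centers and odd ones carry \<open>toep n\<close>.\<close>

lemma center_Suc_shift: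
  assumes "\<omega> \<in> Omega" "center n \<omega> p"
  shows "\<not> center (Suc n) \<omega> p \<longleftrightarrow> center (Suc n) \<omega> (p + 2 ^ n)"
    "\<not> center (Suc n) \<omega> p \<longleftrightarrow> center (Suc n) \<omega> (p - 2 ^ n)"
    "\<not> center (Suc n) \<omega> p \<Longrightarrow> \<omega> p = toep n"
proof -
  obtain r where r: "center (Suc n) \<omega> r" using center_exists[OF assms(1)] .
  then obtain k where k: "p - r = 2 ^ n * k"
    using center_iff[OF assms(1) center_mono[OF r], of n p] assms(2) by auto
  note iff = center_iff[OF assms(1) r]
  have 1: "center (Suc n) \<omega> p \<longleftrightarrow> even k"
    by (simp add: iff k)
  have 2: "center (Suc n) \<omega> (p + 2 ^ n) \<longleftrightarrow> even (k + 1)"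
  proof -
    have "p + 2 ^ n - r = 2 ^ n * (k + 1)" using k by (simp add: algebra_simps)
    then show ?thesis by (simp add: iff)
  qed
  have 3: "center (Suc n) \<omega> (p - 2 ^ n) \<longleftrightarrow> even (k - 1)"
  proof -
    have "p - 2 ^ n - r = 2 ^ n * (k - 1)" using k by (simp add: algebra_simps)
    then show ?thesis by (simp add: iff)
  qed
  show "\<not> center (Suc n) \<omega> p \<longleftrightarrow> center (Suc n) \<omega> (p + 2 ^ n)"
    "\<not> center (Suc n) \<omega> p \<longleftrightarrow> center (Suc n) \<omega> (p - 2 ^ n)"
    using 1 2 3 by simp_all
  assume "\<not> center (Suc n) \<omega> p"
  then obtain t where "k = 2 * t + 1" using 1 by (auto elim: oddE)
  then have "p = r + 2 ^ n * (2 * t + 1)" using k by simp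
  then show "\<omega> p = toep n" using r by (simp only: center_Suc)
qed

text \<open>The letter at \<open>p\<close> is free in the definition of a center, so it is read in
  one window of \<open>xi\<close> together with its neighbour: \<open>p + 1\<close> carries
  \<open>LA\<close>, hence has odd distance from the origin of the window, and \<open>p\<close> has
  even distance.\<close>

lemma center_letter:
  assumes "\<omega> \<in> Omega" "center n \<omega> p" "n > 0"
  shows "\<omega> p \<noteq> LA"
proof -
  obtain p' where p': "p' < p"
    "\<And>i. p \<le> i \<Longrightarrow> i \<le> p + 1 \<Longrightarrow> \<omega> i = toep (multiplicity 2 (i - p'))"
    using Omega_window[OF assms(1), of p "p + 1"] by blast
  have "\<omega> (p + 2 ^ 0 * (2 * 0 + 1)) = toep 0"
    using assms(2,3) unfolding center_def by blast
  then have "toep (multiplicity 2 (p + 1 - p')) = LA"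
    using p'(2)[of "p + 1"] by (simp add: toep_def)
  then have "multiplicity 2 (p + 1 - p') = 0" by (simp add: toep_eq_LA_iff)
  then have "odd (p + 1 - p')"
    using p'(1) by (subst (asm) multiplicity_eq_zero_iff) auto
  then have "multiplicity 2 (p - p') \<noteq> 0"
    using p'(1) by (subst multiplicity_eq_zero_iff) auto
  then show ?thesis using p'(2)[of p] by (simp add: toep_eq_LA_iff)
qed

lemma center_1_iff:
  assumes "\<omega> \<in> Omega"
  shows "center 1 \<omega> p \<longleftrightarrow> \<omega> p \<noteq> LA"
proof
  assume *: "\<omega> p \<noteq> LA"
  obtain r where r: "center 1 \<omega> r" using center_exists[OF assms] .
  show "center 1 \<omega> p"
  proof (rule ccontr)
    assume "\<not> center 1 \<omega> p"
    then have "odd (p - r)" using center_iff[OF assms r] by simp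
    then obtain t where "p - r = 2 * t + 1" by (elim oddE)
    then have "p = r + 2 ^ 0 * (2 * t + 1)" by simp
    then have "\<omega> p = toep 0" using r by (simp only: center_def)
    with * show False by (simp add: toep_def)
  qed
qed (use center_letter[OF assms] in simp)

text \<open>A period preserves the centers of level \<open>n\<close> and is therefore a multiple of
  \<open>2 ^ n\<close>, which is impossible once \<open>2 ^ n\<close> exceeds it.\<close>

lemma translate_aperiodic:
  assumes "\<omega> \<in> Omega" "translate i \<omega> = translate j \<omega>"
  shows "i = j"
proof (rule ccontr)
  assume "i \<noteq> j"
  define n where "n = nat \<bar>i - j\<bar>"
  obtain p where p: "center n \<omega> p" using center_exists[OF assms(1)] .
  then have "center n (translate j \<omega>) (p - j)" by simp
  then have "center n (translate i \<omega>) (p - j)" by (simp only: assms(2))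
  then have "2 ^ n dvd i - j" using center_iff[OF assms(1) p] by simp
  then have "(2::int) ^ n \<le> \<bar>i - j\<bar>" using \<open>i \<noteq> j\<close> by (intro zdvd_imp_le) auto
  moreover have "int n < 2 ^ n" by (rule of_nat_less_two_power)
  then have "\<bar>i - j\<bar> < 2 ^ n" by (simp add: n_def)
  ultimately show False by simp
qed

section \<open>Continuous cocycles\<close>

definition windowed :: "int \<Rightarrow> ((int \<Rightarrow> letter) \<Rightarrow> 'b) \<Rightarrow> bool" where
  "windowed K g \<longleftrightarrow> (\<forall>\<omega>\<in>Omega. \<forall>\<eta>\<in>Omega. (\<forall>j. \<bar>j\<bar> \<le> K \<longrightarrow> \<omega> j = \<eta> j) \<longrightarrow> g \<omega> = g \<eta>)"

lemma windowedD:
  assumes "windowed K g" "\<omega> \<in> Omega" "\<eta> \<in> Omega" "\<And>j. \<bar>j\<bar> \<le> K \<Longrightarrow> \<omega> j = \<eta> j"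
  shows "g \<omega> = g \<eta>"
  using assms unfolding windowed_def by blast

lemma windowed_mono: "windowed K g \<Longrightarrow> K \<le> L \<Longrightarrow> windowed L g"
  unfolding windowed_def by (meson order_trans)

section \<open>Finite windows and compactness\<close>

lemma openin_finite_window:
  assumes "finite J"
  shows "openin (product_topology (\<lambda>_. discrete_topology UNIV) UNIV) {\<eta>. \<forall>j\<in>J. \<eta> j = \<omega> j}"
proof -
  have "{\<eta>. \<forall>j\<in>J. \<eta> j = \<omega> j} = Pi\<^sub>E UNIV (\<lambda>j. if j \<in> J then {\<omega> j} else UNIV)"
    by (auto simp: PiE_def Pi_def split: if_splits)
  moreover have "{i. (if i \<in> J then {\<omega> i} else UNIV) \<noteq> UNIV} \<subseteq> J"
    by auto
  ultimately show ?thesis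
    using product_topology_basis[of "\<lambda>_. discrete_topology UNIV"
        "\<lambda>j. if j \<in> J then {\<omega> j} else UNIV" UNIV] finite_subset[OF _ assms] by simp
qed

lemma finite_window: "finite {j::int. \<bar>j\<bar> \<le> K}"
  by (rule finite_subset[of _ "{- K..K}"]) auto

lemma openin_Omega_window:
  "openin Omega_top {\<eta>\<in>Omega. \<forall>j. \<bar>j\<bar> \<le> K \<longrightarrow> \<eta> j = \<omega> j}"
  unfolding Omega_top_def openin_subtopology
  by (rule exI[of _ "{\<eta>. \<forall>j\<in>{j. \<bar>j\<bar> \<le> K}. \<eta> j = \<omega> j}"])
    (auto intro: openin_finite_window[OF finite_window, simplified])

lemma finite_UNIV_letter: "finite (UNIV :: letter set)"
proof -
  have "UNIV = {LA, LB, LC, LD}" by (auto intro: letter.exhaust)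
  then show ?thesis by (metis finite.simps)
qed

text \<open>A forbidden word is visible in finitely many coordinates, so \<open>Omega\<close> is
  closed in a product of finite spaces.\<close>

lemma compact_space_Omega_top: "compact_space Omega_top"
proof -
  let ?P = "product_topology (\<lambda>_::int. discrete_topology (UNIV :: letter set)) UNIV"
  have "compact_space ?P"
    by (simp add: compact_space_product_topology compact_space_discrete_topology finite_UNIV_letter)
  moreover have "closedin ?P Omega"
  proof -
    have "openin ?P (- Omega)"
    proof (subst openin_subopen, intro ballI)
      fix \<omega> :: "int \<Rightarrow> letter" assume "\<omega> \<in> - Omega"
      then obtain l m where lm: "l \<le> m" "\<not> occurs_in_xi (map \<omega> [l..m])"
        by (auto simp: Omega_def)
      let ?U = "{\<eta>. \<forall>j\<in>{l..m}. \<eta> j = \<omega> j}"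
      have "?U \<subseteq> - Omega"
      proof
        fix \<eta> assume "\<eta> \<in> ?U"
        then have "map \<eta> [l..m] = map \<omega> [l..m]" by simp
        with lm have "l \<le> m \<and> \<not> occurs_in_xi (map \<eta> [l..m])" by metis
        then show "\<eta> \<in> - Omega" unfolding Omega_def by blast
      qed
      then show "\<exists>T. openin ?P T \<and> \<omega> \<in> T \<and> T \<subseteq> - Omega"
        using openin_finite_window[of "{l..m}" \<omega>] by (intro exI[of _ ?U]) simp
    qed
    then show ?thesis by (simp add: closedin_def Compl_eq_Diff_UNIV)
  qed
  ultimately have "compactin ?P Omega" by (rule closedin_compact_space)
  then show ?thesis
    unfolding Omega_top_def by (rule compact_space_subtopology)
qed

text \<open>A continuous map has a radius at each point; a finite subcover by the corresponding
  windows gives a common radius.\<close>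

lemma continuous_map_Omega_discrete_iff:
  "continuous_map Omega_top (discrete_topology UNIV) g \<longleftrightarrow> (\<exists>K. windowed K g)"
proof
  assume "\<exists>K. windowed K g"
  then obtain K where K: "windowed K g" ..
  show "continuous_map Omega_top (discrete_topology UNIV) g"
    unfolding continuous_map_alt
  proof (intro conjI allI impI)
    fix V
    show "openin Omega_top (g -` V \<inter> topspace Omega_top)"
    proof (subst openin_subopen, intro ballI)
      fix \<omega> assume \<omega>: "\<omega> \<in> g -` V \<inter> topspace Omega_top"
      have "{\<eta>\<in>Omega. \<forall>j. \<bar>j\<bar> \<le> K \<longrightarrow> \<eta> j = \<omega> j} \<subseteq> g -` V \<inter> topspace Omega_top"
      proof
        fix \<eta> assume "\<eta> \<in> {\<eta>\<in>Omega. \<forall>j. \<bar>j\<bar> \<le> K \<longrightarrow> \<eta> j = \<omega> j}"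
        then have "g \<eta> = g \<omega>"
          using \<omega> by (intro windowedD[OF K]) (auto simp: topspace_Omega_top)
        then show "\<eta> \<in> g -` V \<inter> topspace Omega_top"
          using \<omega> \<open>\<eta> \<in> _\<close> by (auto simp: topspace_Omega_top)
      qed
      then show "\<exists>T. openin Omega_top T \<and> \<omega> \<in> T \<and> T \<subseteq> g -` V \<inter> topspace Omega_top"
        using \<omega> openin_Omega_window[of K \<omega>] by (auto simp: topspace_Omega_top)
    qed
  qed simp
next
  assume cont: "continuous_map Omega_top (discrete_topology UNIV) g"
  have "\<exists>K. \<forall>\<eta>\<in>Omega. (\<forall>j. \<bar>j\<bar> \<le> K \<longrightarrow> \<eta> j = \<omega> j) \<longrightarrow> g \<eta> = g \<omega>" if "\<omega> \<in> Omega" for \<omega>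
  proof -
    have "openin Omega_top {\<eta> \<in> topspace Omega_top. g \<eta> \<in> {g \<omega>}}"
      using cont by (rule openin_continuous_map_preimage) simp
    then obtain W where W: "openin (product_topology (\<lambda>_. discrete_topology UNIV) UNIV) W"
      "{\<eta> \<in> Omega. g \<eta> = g \<omega>} = W \<inter> Omega"
      unfolding Omega_top_def openin_subtopology by auto
    then have "\<omega> \<in> W" using that by blast
    then obtain U where U: "finite {i. U i \<noteq> (UNIV :: letter set)}" "\<omega> \<in> Pi\<^sub>E UNIV U" "Pi\<^sub>E UNIV U \<subseteq> W"
      using W(1) unfolding openin_product_topology_alt by auto
    have "finite (abs ` {i. U i \<noteq> UNIV})" using U(1) by simp
    then obtain K where K: "\<And>i. U i \<noteq> UNIV \<Longrightarrow> \<bar>i\<bar> \<le> K"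
      by (metis (mono_tags, lifting) bdd_above_finite bdd_above.E imageI mem_Collect_eq)
    have "g \<eta> = g \<omega>" if \<eta>: "\<eta> \<in> Omega" "\<forall>j. \<bar>j\<bar> \<le> K \<longrightarrow> \<eta> j = \<omega> j" for \<eta>
    proof -
      have "\<eta> i \<in> U i" for i
        using U(2) K[of i] \<eta>(2) by (cases "U i = UNIV") (auto simp: PiE_def Pi_def)
      then have "\<eta> \<in> W" using U(3) by auto
      then show ?thesis using W(2) \<eta>(1) by blast
    qed
    then show ?thesis by blast
  qed
  then obtain K where K: "\<And>\<omega> \<eta>. \<omega> \<in> Omega \<Longrightarrow> \<eta> \<in> Omega \<Longrightarrow> \<forall>j. \<bar>j\<bar> \<le> K \<omega> \<longrightarrow> \<eta> j = \<omega> j \<Longrightarrow> g \<eta> = g \<omega>"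
    by metis
  define Z where "Z \<omega> = {\<eta>\<in>Omega. \<forall>j. \<bar>j\<bar> \<le> K \<omega> \<longrightarrow> \<eta> j = \<omega> j}" for \<omega>
  have "compactin Omega_top Omega"
    using compact_space_Omega_top by (simp add: compact_space_def topspace_Omega_top)
  moreover have "\<forall>U\<in>Z ` Omega. openin Omega_top U"
    by (auto simp: Z_def openin_Omega_window)
  moreover have "Omega \<subseteq> \<Union> (Z ` Omega)"
    by (auto simp: Z_def)
  ultimately obtain F where F: "finite F" "F \<subseteq> Z ` Omega" "Omega \<subseteq> \<Union> F"
    unfolding compactin_def by metis
  then obtain C where C: "finite C" "C \<subseteq> Omega" "F = Z ` C"
    by (meson finite_subset_image)
  have "finite (K ` C)" using C(1) by simp
  then obtain L where L: "\<And>\<omega>. \<omega> \<in> C \<Longrightarrow> K \<omega> \<le> L"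
    by (metis bdd_above_finite bdd_above.E imageI)
  have "windowed L g"
    unfolding windowed_def
  proof (intro ballI impI)
    fix \<omega> \<eta> assume *: "\<omega> \<in> Omega" "\<eta> \<in> Omega" "\<forall>j. \<bar>j\<bar> \<le> L \<longrightarrow> \<omega> j = \<eta> j"
    obtain \<zeta> where \<zeta>: "\<zeta> \<in> C" "\<omega> \<in> Z \<zeta>" using F(3) C(3) *(1) by blast
    then have "\<eta> \<in> Z \<zeta>" using * L[OF \<zeta>(1)] by (auto simp: Z_def)
    then have "g \<omega> = g \<zeta>" "g \<eta> = g \<zeta>"
      using \<zeta> K[of \<zeta> \<omega>] K[of \<zeta> \<eta>] C(2) unfolding Z_def by blast+
    then show "g \<omega> = g \<eta>" by simp
  qed
  then show "\<exists>K. windowed K g" ..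
qed

lemma windowed_finite_image:
  assumes "windowed K g"
  shows "finite (g ` Omega)"
proof -
  define r where "r \<omega> = restrict \<omega> {- K..K}" for \<omega> :: "int \<Rightarrow> letter"
  have "r ` Omega \<subseteq> Pi\<^sub>E {- K..K} (\<lambda>_. UNIV)" by (auto simp: r_def)
  then have "finite (r ` Omega)"
    by (rule finite_subset) (simp add: finite_PiE finite_UNIV_letter)
  moreover have "g \<omega> = g (inv_into Omega r (r \<omega>))" if "\<omega> \<in> Omega" for \<omega>
  proof -
    let ?\<eta> = "inv_into Omega r (r \<omega>)"
    have \<eta>: "?\<eta> \<in> Omega" "r ?\<eta> = r \<omega>"
      using that by (simp_all add: inv_into_into f_inv_into_f)
    have "\<omega> j = ?\<eta> j" if "\<bar>j\<bar> \<le> K" for j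
      using fun_cong[OF \<eta>(2), of j] that by (simp add: r_def abs_le_iff split: if_splits)
    then show ?thesis using that \<eta>(1) by (intro windowedD[OF assms]) auto
  qed
  then have "g ` Omega = (\<lambda>x. g (inv_into Omega r x)) ` (r ` Omega)"
    by (auto simp: image_iff)
  ultimately show ?thesis by simp
qed

text \<open>One constant serves as radius and as bound, so that windows of translated words can be
  estimated with it.\<close>

lemma windowed_bounded:
  fixes \<nu> :: "(int \<Rightarrow> letter) \<Rightarrow> int"
  assumes "windowed K \<nu>"
  obtains L where "L \<ge> 0" "windowed L \<nu>" "\<And>\<omega>. \<omega> \<in> Omega \<Longrightarrow> \<bar>\<nu> \<omega>\<bar> \<le> L"
proof -
  have "finite ((\<lambda>\<omega>. \<bar>\<nu> \<omega>\<bar>) ` Omega)"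
    using windowed_finite_image[OF assms] by (simp flip: image_image[of abs \<nu>])
  then obtain M where M: "\<And>\<omega>. \<omega> \<in> Omega \<Longrightarrow> \<bar>\<nu> \<omega>\<bar> \<le> M"
    by (metis (mono_tags, lifting) bdd_above_finite bdd_above.E imageI)
  show ?thesis
    by (rule that[of "max 0 (max K M)"]) (use M windowed_mono[OF assms] in fastforce)+
qed

section \<open>The topological full group\<close>

lemma BijGroup_simps:
  "carrier (BijGroup S) = Bij S" "\<one>\<^bsub>BijGroup S\<^esub> = (\<lambda>x\<in>S. x)"
  "f \<in> Bij S \<Longrightarrow> g \<in> Bij S \<Longrightarrow> f \<otimes>\<^bsub>BijGroup S\<^esub> g = compose S f g"
  by (simp_all add: BijGroup_def)

lemma restrict_translate_Bij: "(\<lambda>\<omega>\<in>Omega. translate k \<omega>) \<in> Bij Omega"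
proof -
  have "bij_betw (\<lambda>\<omega>\<in>Omega. translate k \<omega>) Omega Omega"
    by (rule bij_betw_byWitness[where f' = "translate (- k)"]) auto
  then show ?thesis by (simp add: Bij_def)
qed

lemma compose_restrict_translate:
  "compose Omega (\<lambda>\<omega>\<in>Omega. translate j \<omega>) (\<lambda>\<omega>\<in>Omega. translate k \<omega>) = (\<lambda>\<omega>\<in>Omega. translate (j + k) \<omega>)"
  by (auto simp: compose_def)

lemma Shift_int_pow:
  "Shift [^]\<^bsub>BijGroup Omega\<^esub> (k :: int) = (\<lambda>\<omega>\<in>Omega. translate k \<omega>)"
proof -
  interpret group "BijGroup Omega" by (rule group_BijGroup)
  have Shift: "Shift = (\<lambda>\<omega>\<in>Omega. translate 1 \<omega>)"
    by (auto simp: Shift_def translate_def)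
  have nat: "Shift [^]\<^bsub>BijGroup Omega\<^esub> n = (\<lambda>\<omega>\<in>Omega. translate (int n) \<omega>)" for n :: nat
  proof (induction n)
    case (Suc n)
    have "Shift [^]\<^bsub>BijGroup Omega\<^esub> Suc n
        = (\<lambda>\<omega>\<in>Omega. translate (int n) \<omega>) \<otimes>\<^bsub>BijGroup Omega\<^esub> Shift"
      by (simp only: nat_pow_Suc Suc.IH)
    also have "\<dots> = (\<lambda>\<omega>\<in>Omega. translate (int n) \<omega>) \<otimes>\<^bsub>BijGroup Omega\<^esub> (\<lambda>\<omega>\<in>Omega. translate 1 \<omega>)"
      by (simp only: Shift)
    also have "\<dots> = (\<lambda>\<omega>\<in>Omega. translate (int n + 1) \<omega>)"
      by (simp only: BijGroup_simps(3)[OF restrict_translate_Bij restrict_translate_Bij]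
          compose_restrict_translate)
    finally show ?case by (simp only: of_nat_Suc add.commute)
  qed (simp add: BijGroup_simps)
  show ?thesis
  proof (cases "k \<ge> 0")
    case True
    then show ?thesis using nat[of "nat k"] int_pow_int[of "BijGroup Omega" Shift "nat k"] by simp
  next
    case False
    then have "Shift [^]\<^bsub>BijGroup Omega\<^esub> k = inv\<^bsub>BijGroup Omega\<^esub> (Shift [^]\<^bsub>BijGroup Omega\<^esub> nat (- k))"
      by (simp only: int_pow_def2 not_le if_True)
    also have "\<dots> = (\<lambda>\<omega>\<in>Omega. translate k \<omega>)"
      unfolding nat using False
      by (intro inv_equality)
        (simp_all add: BijGroup_simps restrict_translate_Bij compose_restrict_translate cong: restrict_cong)
    finally show ?thesis .
  qed
qed

text \<open>A continuous bijection of a compact Hausdorff space is a homeomorphism. Coordinate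
  \<open>j\<close> of the image is read at \<open>j + \<nu> \<omega>\<close>, hence the radius
  \<open>\<bar>j\<bar> + L\<close>.\<close>

lemma homeomorphic_map_cocycle:
  assumes f: "f \<in> Bij Omega" and \<nu>: "windowed K \<nu>" "\<And>\<omega>. \<omega> \<in> Omega \<Longrightarrow> f \<omega> = translate (\<nu> \<omega>) \<omega>"
  shows "homeomorphic_map Omega_top Omega_top f"
proof (rule continuous_imp_homeomorphic_map)
  show "f ` topspace Omega_top = topspace Omega_top" "inj_on f (topspace Omega_top)"
    using f by (simp_all add: Bij_def bij_betw_def topspace_Omega_top)
  show "Hausdorff_space Omega_top"
    unfolding Omega_top_def
    by (intro Hausdorff_space_subtopology) (simp add: Hausdorff_space_product_topology)
  obtain L where L: "L \<ge> 0" "windowed L \<nu>" "\<And>\<omega>. \<omega> \<in> Omega \<Longrightarrow> \<bar>\<nu> \<omega>\<bar> \<le> L"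
    using windowed_bounded[OF \<nu>(1)] by blast
  have "windowed (\<bar>j\<bar> + L) (\<lambda>\<omega>. f \<omega> j)" for j
    unfolding windowed_def
  proof (intro ballI impI)
    fix \<omega> \<eta> assume *: "\<omega> \<in> Omega" "\<eta> \<in> Omega" "\<forall>i. \<bar>i\<bar> \<le> \<bar>j\<bar> + L \<longrightarrow> \<omega> i = \<eta> i"
    have "\<nu> \<omega> = \<nu> \<eta>" using * by (intro windowedD[OF L(2)]) auto
    moreover have "\<omega> (j + \<nu> \<omega>) = \<eta> (j + \<nu> \<omega>)" using *(3) L(3)[OF *(1)] by auto
    ultimately show "f \<omega> j = f \<eta> j" using \<nu>(2) * by simp
  qed
  then have "continuous_map Omega_top (product_topology (\<lambda>_. discrete_topology UNIV) UNIV) f"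
    using continuous_map_Omega_discrete_iff by (simp add: continuous_map_componentwise_UNIV) blast
  moreover have "f ` Omega \<subseteq> Omega" using Bij_imp_funcset[OF f] by auto
  ultimately show "continuous_map Omega_top Omega_top f"
    by (subst (2) Omega_top_def)
      (auto simp: continuous_map_in_subtopology topspace_Omega_top)
qed (rule compact_space_Omega_top)

lemma mem_full_group_carrier_iff:
  "f \<in> full_group_carrier Omega_top Shift \<longleftrightarrow>
     f \<in> Bij Omega \<and> (\<exists>\<nu> K. windowed K \<nu> \<and> (\<forall>\<omega>\<in>Omega. f \<omega> = translate (\<nu> \<omega>) \<omega>))"
proof -
  have "(\<forall>x\<in>Omega. f x = (Shift [^]\<^bsub>BijGroup Omega\<^esub> nu x) x) \<longleftrightarrow> (\<forall>x\<in>Omega. f x = translate (nu x) x)"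
    for nu :: "(int \<Rightarrow> letter) \<Rightarrow> int"
    by (simp add: Shift_int_pow)
  then show ?thesis
    using homeomorphic_map_cocycle[of f]
    unfolding full_group_carrier_def continuous_map_Omega_discrete_iff topspace_Omega_top by blast
qed

text \<open>For products the window of the combined cocycle is computed directly. The cocycle of the
  inverse \<open>h\<close> is the negative of \<open>\<nu> \<circ> h\<close>, and continuity of
  \<open>h\<close> supplies its window.\<close>

lemma subgroup_full_group_carrier:
  "subgroup (full_group_carrier Omega_top Shift) (BijGroup Omega)"
proof (rule subgroup.intro)
  show "full_group_carrier Omega_top Shift \<subseteq> carrier (BijGroup Omega)"
    by (auto simp: mem_full_group_carrier_iff BijGroup_simps)
next
  fix f g assume "f \<in> full_group_carrier Omega_top Shift" "g \<in> full_group_carrier Omega_top Shift"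
  then obtain \<mu> L \<nu> K where f: "f \<in> Bij Omega" "windowed L \<mu>" "\<And>\<omega>. \<omega> \<in> Omega \<Longrightarrow> f \<omega> = translate (\<mu> \<omega>) \<omega>"
    and g: "g \<in> Bij Omega" "windowed K \<nu>" "\<And>\<omega>. \<omega> \<in> Omega \<Longrightarrow> g \<omega> = translate (\<nu> \<omega>) \<omega>"
    unfolding mem_full_group_carrier_iff by blast
  obtain K' where K': "K' \<ge> 0" "windowed K' \<nu>" "\<And>\<omega>. \<omega> \<in> Omega \<Longrightarrow> \<bar>\<nu> \<omega>\<bar> \<le> K'"
    using windowed_bounded[OF g(2)] by blast
  have "windowed (\<bar>L\<bar> + K') (\<lambda>\<omega>. \<mu> (translate (\<nu> \<omega>) \<omega>) + \<nu> \<omega>)"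
    unfolding windowed_def
  proof (intro ballI impI)
    fix \<omega> \<eta> assume *: "\<omega> \<in> Omega" "\<eta> \<in> Omega" "\<forall>j. \<bar>j\<bar> \<le> \<bar>L\<bar> + K' \<longrightarrow> \<omega> j = \<eta> j"
    have \<nu>: "\<nu> \<omega> = \<nu> \<eta>" using * by (intro windowedD[OF K'(2)]) auto
    moreover have "\<mu> (translate (\<nu> \<omega>) \<omega>) = \<mu> (translate (\<nu> \<omega>) \<eta>)"
    proof (rule windowedD[OF f(2)])
      fix j assume "\<bar>j\<bar> \<le> L"
      then have "\<bar>j + \<nu> \<omega>\<bar> \<le> \<bar>L\<bar> + K'" using K'(3)[OF *(1)] by linarith
      then show "translate (\<nu> \<omega>) \<omega> j = translate (\<nu> \<omega>) \<eta> j" using *(3) by simp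
    qed (use * in simp_all)
    ultimately show "\<mu> (translate (\<nu> \<omega>) \<omega>) + \<nu> \<omega> = \<mu> (translate (\<nu> \<eta>) \<eta>) + \<nu> \<eta>" by simp
  qed
  moreover have "compose Omega f g \<omega> = translate (\<mu> (translate (\<nu> \<omega>) \<omega>) + \<nu> \<omega>) \<omega>" if "\<omega> \<in> Omega" for \<omega>
    using that f(3) g(3) by (simp add: compose_def)
  ultimately show "f \<otimes>\<^bsub>BijGroup Omega\<^esub> g \<in> full_group_carrier Omega_top Shift"
    using f(1) g(1) compose_Bij[OF f(1) g(1)]
    unfolding mem_full_group_carrier_iff BijGroup_simps(3)[OF f(1) g(1)] by blast
next
  have "windowed 0 (\<lambda>_. 0 :: int)" by (simp add: windowed_def)
  then show "\<one>\<^bsub>BijGroup Omega\<^esub> \<in> full_group_carrier Omega_top Shift"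
    unfolding mem_full_group_carrier_iff BijGroup_simps by (auto simp: id_Bij)
next
  fix f assume f: "f \<in> full_group_carrier Omega_top Shift"
  then obtain \<nu> where \<nu>: "f \<in> Bij Omega" "continuous_map Omega_top (discrete_topology UNIV) \<nu>"
    "\<And>\<omega>. \<omega> \<in> Omega \<Longrightarrow> f \<omega> = translate (\<nu> \<omega>) \<omega>"
    unfolding mem_full_group_carrier_iff continuous_map_Omega_discrete_iff by blast
  have bij: "bij_betw f Omega Omega" using \<nu>(1) by (simp add: Bij_def)
  obtain h where "homeomorphic_maps Omega_top Omega_top f h"
    using f unfolding full_group_carrier_def homeomorphic_map_maps by blast
  then have h: "continuous_map Omega_top Omega_top h" "\<And>\<omega>. \<omega> \<in> Omega \<Longrightarrow> f (h \<omega>) = \<omega>"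
    "\<And>\<omega>. \<omega> \<in> Omega \<Longrightarrow> h \<omega> \<in> Omega"
    by (auto simp: homeomorphic_maps_def topspace_Omega_top continuous_map_def)
  have "continuous_map Omega_top (discrete_topology UNIV) ((\<lambda>i. - i) \<circ> (\<nu> \<circ> h))"
    by (intro continuous_map_compose[OF h(1)] continuous_map_compose[of _ "discrete_topology UNIV"] \<nu>(2))
      simp_all
  moreover have "(\<lambda>\<omega>\<in>Omega. inv_into Omega f \<omega>) \<omega> = translate (((\<lambda>i. - i) \<circ> (\<nu> \<circ> h)) \<omega>) \<omega>"
    if "\<omega> \<in> Omega" for \<omega>
  proof -
    have "inv_into Omega f \<omega> = h \<omega>"
      using h that bij by (intro inv_into_f_eq) (auto simp: bij_betw_def)
    also have "\<dots> = translate (- \<nu> (h \<omega>)) (f (h \<omega>))"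
      using \<nu>(3)[OF h(3)[OF that]] by simp
    finally show ?thesis using that h(2) by simp
  qed
  ultimately show "inv\<^bsub>BijGroup Omega\<^esub> f \<in> full_group_carrier Omega_top Shift"
    unfolding mem_full_group_carrier_iff inv_BijGroup[OF \<nu>(1)] continuous_map_Omega_discrete_iff
    using restrict_inv_into_Bij[OF \<nu>(1)] by blast
qed

section \<open>Block permutations of the integers\<close>

definition spaced :: "int \<Rightarrow> (int \<Rightarrow> bool) \<Rightarrow> bool" where
  "spaced L c \<longleftrightarrow> (\<forall>b b'. c b \<longrightarrow> c b' \<longrightarrow> b \<noteq> b' \<longrightarrow> L < \<bar>b - b'\<bar>)"

text \<open>For \<open>spaced 1 u\<close> this is a product of disjoint transpositions: the trace of
  a \<open>delta\<close> on one orbit.\<close>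

definition swap_at :: "(int \<Rightarrow> bool) \<Rightarrow> int \<Rightarrow> int" where
  "swap_at u i = (if u i then i + 1 else if u (i - 1) then i - 1 else i)"

text \<open>Coordinates relative to the block start let one permutation act on many blocks. Under
  \<open>spaced L c\<close> the blocks are disjoint, so \<open>THE\<close> picks the only
  candidate.\<close>

definition block_perm :: "int \<Rightarrow> (int \<Rightarrow> bool) \<Rightarrow> (int \<Rightarrow> int \<Rightarrow> int) \<Rightarrow> int \<Rightarrow> int" where
  "block_perm L c \<sigma> i =
     (if \<exists>b. c b \<and> b \<le> i \<and> i \<le> b + L
      then (let b = THE b. c b \<and> b \<le> i \<and> i \<le> b + L in b + \<sigma> b (i - b)) else i)"

lemma spaced_mono: "spaced L c \<Longrightarrow> (\<And>b. u b \<Longrightarrow> c b) \<Longrightarrow> K \<le> L \<Longrightarrow> spaced K u"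
  unfolding spaced_def by (meson le_less_trans)

lemma spaced_shift: "spaced L c \<Longrightarrow> spaced L (\<lambda>i. c (i + k))"
  unfolding spaced_def
proof (intro allI impI)
  fix b b' assume *: "\<forall>b b'. c b \<longrightarrow> c b' \<longrightarrow> b \<noteq> b' \<longrightarrow> L < \<bar>b - b'\<bar>"
    "c (b + k)" "c (b' + k)" "b \<noteq> b'"
  then have "L < \<bar>(b + k) - (b' + k)\<bar>" by (metis add_right_cancel)
  then show "L < \<bar>b - b'\<bar>" by simp
qed

lemma block_perm_in:
  assumes "spaced L c" "c b" "0 \<le> j" "j \<le> L"
  shows "block_perm L c \<sigma> (b + j) = b + \<sigma> b j"
proof -
  have uniq: "b' = b" if "c b'" "b' \<le> b + j" "b + j \<le> b' + L" for b'
  proof (rule ccontr)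
    assume "b' \<noteq> b"
    then have "L < \<bar>b' - b\<bar>" using assms(1,2) that(1) by (simp add: spaced_def)
    then show False using that assms(3,4) by linarith
  qed
  have "(THE b'. c b' \<and> b' \<le> b + j \<and> b + j \<le> b' + L) = b"
    by (rule the_equality) (use assms uniq in auto)
  moreover have "\<exists>b'. c b' \<and> b' \<le> b + j \<and> b + j \<le> b' + L"
    using assms by (intro exI[of _ b]) auto
  ultimately show ?thesis by (simp add: block_perm_def Let_def)
qed

lemma block_perm_out:
  "(\<And>b. c b \<Longrightarrow> b \<le> i \<Longrightarrow> i \<le> b + L \<Longrightarrow> False) \<Longrightarrow> block_perm L c \<sigma> i = i"
  unfolding block_perm_def by (metis (full_types))

lemma block_cases:
  fixes i :: int and c :: "int \<Rightarrow> bool" and L :: int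
  obtains (In) b j where "c b" "0 \<le> j" "j \<le> L" "i = b + j"
  | (Out) "\<And>b. c b \<Longrightarrow> b \<le> i \<Longrightarrow> i \<le> b + L \<Longrightarrow> False"
proof (cases "\<exists>b. c b \<and> b \<le> i \<and> i \<le> b + L")
  case True
  then obtain b where "c b" "b \<le> i" "i \<le> b + L" by blast
  then show ?thesis using In[of b "i - b"] by simp
next
  case False
  then show ?thesis using Out by blast
qed

lemma block_perm_eqI:
  assumes "spaced L c"
    and "\<And>b j. c b \<Longrightarrow> 0 \<le> j \<Longrightarrow> j \<le> L \<Longrightarrow> f (b + j) = b + \<sigma> b j"
    and "\<And>i. (\<And>b. c b \<Longrightarrow> b \<le> i \<Longrightarrow> i \<le> b + L \<Longrightarrow> False) \<Longrightarrow> f i = i"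
  shows "f = block_perm L c \<sigma>"
proof
  fix i
  show "f i = block_perm L c \<sigma> i"
  proof (cases rule: block_cases[where i = i and c = c and L = L])
    case (In b j)
    then show ?thesis using assms(2) block_perm_in[OF assms(1)] by simp
  next
    case Out
    then show ?thesis using assms(3) block_perm_out by metis
  qed
qed

lemma block_perm_cong:
  assumes "spaced L c" "\<And>b j. c b \<Longrightarrow> 0 \<le> j \<Longrightarrow> j \<le> L \<Longrightarrow> \<sigma> b j = \<tau> b j"
  shows "block_perm L c \<sigma> = block_perm L c \<tau>"
  by (rule block_perm_eqI[OF assms(1)]) (simp add: block_perm_in[OF assms(1)] assms(2), metis block_perm_out)

lemma block_perm_2_cong:
  assumes "spaced 2 c"
    and "\<And>b. c b \<Longrightarrow> \<sigma> b 0 = \<tau> b 0 \<and> \<sigma> b 1 = \<tau> b 1 \<and> \<sigma> b 2 = \<tau> b 2"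
  shows "block_perm 2 c \<sigma> = block_perm 2 c \<tau>"
proof (rule block_perm_cong[OF assms(1)])
  fix b j :: int assume "c b" "0 \<le> j" "j \<le> 2"
  then have "j = 0 \<or> j = 1 \<or> j = 2" by linarith
  then show "\<sigma> b j = \<tau> b j" using assms(2)[OF \<open>c b\<close>] by auto
qed

lemma block_perm_comp:
  assumes "spaced L c" "\<And>b. c b \<Longrightarrow> \<sigma> b permutes {0..L}"
  shows "block_perm L c \<tau> \<circ> block_perm L c \<sigma> = block_perm L c (\<lambda>b. \<tau> b \<circ> \<sigma> b)"
proof (rule block_perm_eqI[OF assms(1)])
  fix b j assume *: "c b" "0 \<le> j" "j \<le> L"
  then have "\<sigma> b j \<in> {0..L}" using permutes_in_image[OF assms(2)[OF *(1)]] by simp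
  then show "(block_perm L c \<tau> \<circ> block_perm L c \<sigma>) (b + j) = b + (\<tau> b \<circ> \<sigma> b) j"
    using * block_perm_in[OF assms(1)] by simp
next
  fix i assume "\<And>b. c b \<Longrightarrow> b \<le> i \<Longrightarrow> i \<le> b + L \<Longrightarrow> False"
  then have "block_perm L c \<rho> i = i" for \<rho> by (rule block_perm_out)
  then show "(block_perm L c \<tau> \<circ> block_perm L c \<sigma>) i = i" by simp
qed

lemma block_perm_shift:
  assumes "spaced L c" "spaced L c'" "\<And>b. c b \<longleftrightarrow> c' (b + k)" "\<And>b. \<sigma> b = \<sigma>' (b + k)"
  shows "block_perm L c' \<sigma>' (i + k) = block_perm L c \<sigma> i + k"
proof (cases rule: block_cases[where i = i and c = c and L = L])
  case (In b j)
  then show ?thesis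
    using block_perm_in[OF assms(1), of b j \<sigma>] block_perm_in[OF assms(2), of "b + k" j \<sigma>'] assms(3,4)[of b]
    by (simp add: algebra_simps)
next
  case Out
  have "block_perm L c' \<sigma>' (i + k) = i + k"
  proof (rule block_perm_out)
    fix b assume "c' b" "b \<le> i + k" "i + k \<le> b + L"
    then show False using Out[of "b - k"] assms(3)[of "b - k"] by simp
  qed
  then show ?thesis using block_perm_out[of c i L \<sigma>] Out by metis
qed

text \<open>Blocks are disjoint intervals, each mapped to itself, so no point jumps over a block or
  into it. Crossings of a cut can then be counted inside the one block around it.\<close>

lemma block_perm_preserves_order:
  assumes "spaced L c" "\<And>b. c b \<Longrightarrow> \<sigma> b permutes {0..L}" "c b"
  shows "w < b \<Longrightarrow> block_perm L c \<sigma> w < b" "b + L < w \<Longrightarrow> b + L < block_perm L c \<sigma> w"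
proof -
  have "(w < b \<longrightarrow> block_perm L c \<sigma> w < b) \<and> (b + L < w \<longrightarrow> b + L < block_perm L c \<sigma> w)"
  proof (cases rule: block_cases[where i = w and c = c and L = L])
    case (In b' j)
    have "0 \<le> \<sigma> b' j" "\<sigma> b' j \<le> L"
      using permutes_in_image[OF assms(2)[OF In(1)], of j] In by auto
    moreover have "b' = b \<or> L < \<bar>b' - b\<bar>"
      using assms(1,3) In(1) by (auto simp: spaced_def)
    moreover have "block_perm L c \<sigma> w = b' + \<sigma> b' j"
      using block_perm_in[OF assms(1) In(1-3)] In(4) by simp
    ultimately show ?thesis using In(2-4) by linarith
  next
    case Out
    then have "block_perm L c \<sigma> w = w" by (rule block_perm_out)
    then show ?thesis by simp
  qed
  then show "w < b \<Longrightarrow> block_perm L c \<sigma> w < b" "b + L < w \<Longrightarrow> b + L < block_perm L c \<sigma> w"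
    by blast+
qed

lemma block_perm_id: "spaced L c \<Longrightarrow> block_perm L c (\<lambda>_. id) = id"
  by (rule block_perm_eqI[symmetric]) simp_all

text \<open>Turns a translate of a swap into an adjacent transposition of levels. A point of
  \<open>u\<close> within distance \<open>L\<close> of a block start is that start, which excludes
  interference between blocks.\<close>

lemma swap_at_eq_block_perm:
  assumes "spaced L c" "0 \<le> j" "j < L" "\<And>b. u b \<Longrightarrow> c b"
  shows "swap_at (\<lambda>i. u (i - j)) = block_perm L c (\<lambda>b. if u b then Transposition.transpose j (j + 1) else id)"
proof (rule block_perm_eqI[OF assms(1)])
  fix b k assume *: "c b" "0 \<le> k" "k \<le> L"
  have far: "b' = b" if "u b'" "\<bar>b' - b\<bar> \<le> L" for b'
    using assms(1) *(1) assms(4)[OF that(1)] that(2) unfolding spaced_def by (meson not_le)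
  have "b + k - j = b" if "u (b + k - j)"
    using far[OF that] * assms(2,3) by linarith
  moreover have "b + k - j = b \<longleftrightarrow> k = j" by linarith
  ultimately have "u (b + k - j) \<longleftrightarrow> u b \<and> k = j" by metis
  moreover
  have "b + k - 1 - j = b" if "u (b + k - 1 - j)"
    using far[OF that] * assms(2,3) by linarith
  moreover have "b + k - 1 - j = b \<longleftrightarrow> k = j + 1" by linarith
  ultimately have "u (b + k - 1 - j) \<longleftrightarrow> u b \<and> k = j + 1" by metis
  note \<open>u (b + k - j) \<longleftrightarrow> u b \<and> k = j\<close> this
  then show "swap_at (\<lambda>i. u (i - j)) (b + k) = b + (if u b then Transposition.transpose j (j + 1) else id) k"
    by (auto simp: swap_at_def Transposition.transpose_def)
next
  fix i assume out: "\<And>b. c b \<Longrightarrow> b \<le> i \<Longrightarrow> i \<le> b + L \<Longrightarrow> False"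
  have "\<not> u (i - j)" "\<not> u (i - 1 - j)"
    using out[of "i - j"] out[of "i - 1 - j"] assms by auto
  then show "swap_at (\<lambda>i. u (i - j)) i = i" by (simp add: swap_at_def)
qed

lemma swap_at_involution:
  assumes "spaced 1 u"
  shows "swap_at u \<circ> swap_at u = id"
proof
  fix i
  have far: "\<not> (u b \<and> u (b + 1))" for b
    using assms unfolding spaced_def by (metis abs_minus_commute abs_one add_diff_cancel_left' less_irrefl add_cancel_right_right zero_neq_one)
  show "(swap_at u \<circ> swap_at u) i = id i"
    using far[of i] far[of "i - 1"] by (auto simp: swap_at_def)
qed

lemma swap_at_disj:
  assumes "spaced 1 (\<lambda>i. u i \<or> v i)" "\<And>i. u i \<Longrightarrow> v i \<Longrightarrow> False"
  shows "swap_at (\<lambda>i. u i \<or> v i) = swap_at u \<circ> swap_at v"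
proof
  fix i
  have far: "\<not> ((u b \<or> v b) \<and> (u (b + 1) \<or> v (b + 1)))" for b
    using assms(1) unfolding spaced_def by (metis abs_minus_commute abs_one add_diff_cancel_left' less_irrefl add_cancel_right_right zero_neq_one)
  show "swap_at (\<lambda>i. u i \<or> v i) i = (swap_at u \<circ> swap_at v) i"
    using far[of i] far[of "i - 1"] far[of "i - 2"] assms(2)[of i] assms(2)[of "i - 1"]
    by (auto simp: swap_at_def)
qed

text \<open>On a block carrying both \<open>u\<close> and \<open>v\<close>, the right-hand side is a commutator of a 3-cycle and a
  transposition in the symmetric group of three levels; on all other blocks the factors cancel.\<close>

lemma swap_at_cycle_conj:
  assumes "spaced 2 c" "\<forall>b. u b \<longrightarrow> c b" "\<forall>b. v b \<longrightarrow> c b"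
  defines "w \<equiv> \<lambda>i. u i \<and> v i"
  shows "swap_at w \<circ> swap_at (\<lambda>i. w (i - 1)) =
      swap_at v \<circ> (swap_at u \<circ> swap_at (\<lambda>i. u (i - 1))) \<circ> swap_at v \<circ> (swap_at (\<lambda>i. u (i - 1)) \<circ> swap_at u)"
    and "swap_at (\<lambda>i. w (i - 1)) \<circ> swap_at w =
      (swap_at u \<circ> swap_at (\<lambda>i. u (i - 1))) \<circ> swap_at v \<circ> (swap_at (\<lambda>i. u (i - 1)) \<circ> swap_at u) \<circ> swap_at v"
proof -
  let ?t = "\<lambda>j u b. if u b then Transposition.transpose j (j + 1) else (id :: int \<Rightarrow> int)"
  have t: "?t j x b permutes {0..2}" if "j = 0 \<or> j = 1" for j :: int and x :: "int \<Rightarrow> bool" and b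
    using that by (auto intro!: permutes_swap_id permutes_id)
  have 0: "swap_at x = block_perm 2 c (?t 0 x)" if "\<forall>b. x b \<longrightarrow> c b" for x
    using swap_at_eq_block_perm[OF assms(1), of 0 x] that by simp
  have 1: "swap_at (\<lambda>i. x (i - 1)) = block_perm 2 c (?t 1 x)" if "\<forall>b. x b \<longrightarrow> c b" for x
    using swap_at_eq_block_perm[OF assms(1), of 1 x] that by simp
  have "\<forall>b. w b \<longrightarrow> c b" "\<forall>b. u b \<longrightarrow> c b" "\<forall>b. v b \<longrightarrow> c b"
    using assms(2,3) by (auto simp: w_def)
  note rules = this[THEN 0] this(1,2)[THEN 1]
  note comp = block_perm_comp[OF assms(1)]
  show "swap_at w \<circ> swap_at (\<lambda>i. w (i - 1)) =
      swap_at v \<circ> (swap_at u \<circ> swap_at (\<lambda>i. u (i - 1))) \<circ> swap_at v \<circ> (swap_at (\<lambda>i. u (i - 1)) \<circ> swap_at u)"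
    unfolding rules
    by (simp only: comp permutes_compose t simp_thms, rule block_perm_2_cong[OF assms(1)])
      (auto simp: w_def Transposition.transpose_def)
  show "swap_at (\<lambda>i. w (i - 1)) \<circ> swap_at w =
      (swap_at u \<circ> swap_at (\<lambda>i. u (i - 1))) \<circ> swap_at v \<circ> (swap_at (\<lambda>i. u (i - 1)) \<circ> swap_at u) \<circ> swap_at v"
    unfolding rules
    by (simp only: comp permutes_compose t simp_thms, rule block_perm_2_cong[OF assms(1)])
      (auto simp: w_def Transposition.transpose_def)
qed

section \<open>The generated subgroup acting on orbits\<close>

text \<open>An equivariant family of self-maps of the integers describes a self-map of the subshift by its
  action on the positions of each orbit; composition of maps becomes composition of the families.\<close>

definition equivariant :: "((int \<Rightarrow> letter) \<Rightarrow> int \<Rightarrow> int) \<Rightarrow> bool" where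
  "equivariant \<phi> \<longleftrightarrow> (\<forall>\<omega>\<in>Omega. \<forall>k i. \<phi> (translate k \<omega>) i = \<phi> \<omega> (i + k) - k)"

text \<open>For a predicate: \<open>u \<omega>\<close> lists the times at which the orbit of
  \<open>\<omega>\<close> visits a fixed subset of the subshift.\<close>

definition stationary :: "((int \<Rightarrow> letter) \<Rightarrow> int \<Rightarrow> 'b) \<Rightarrow> bool" where
  "stationary u \<longleftrightarrow> (\<forall>\<omega>\<in>Omega. \<forall>k i. u (translate k \<omega>) i = u \<omega> (i + k))"

definition orbit_map :: "((int \<Rightarrow> letter) \<Rightarrow> int \<Rightarrow> int) \<Rightarrow> (int \<Rightarrow> letter) \<Rightarrow> int \<Rightarrow> letter" where
  "orbit_map \<phi> = (\<lambda>\<omega>\<in>Omega. translate (\<phi> \<omega> 0) \<omega>)"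

lemma compose_orbit_map:
  "equivariant \<phi> \<Longrightarrow> compose Omega (orbit_map \<phi>) (orbit_map \<psi>) = orbit_map (\<lambda>\<omega>. \<phi> \<omega> \<circ> \<psi> \<omega>)"
  by (auto simp: compose_def orbit_map_def equivariant_def)

lemma equivariant_comp:
  "equivariant \<phi> \<Longrightarrow> equivariant \<psi> \<Longrightarrow> equivariant (\<lambda>\<omega>. \<phi> \<omega> \<circ> \<psi> \<omega>)"
  by (simp add: equivariant_def)

lemma equivariant_swap_at: "stationary u \<Longrightarrow> equivariant (\<lambda>\<omega>. swap_at (u \<omega>))"
  by (auto simp: equivariant_def stationary_def swap_at_def algebra_simps)

lemma stationary_shift: "stationary u \<Longrightarrow> stationary (\<lambda>\<omega> i. u \<omega> (i + k))"
  by (simp add: stationary_def algebra_simps)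

text \<open>The word begins at \<open>i + 1\<close> because \<open>[.w]\<close> is read from
  position 1; thus \<open>i\<close> is a time at which the orbit is in the cylinder.\<close>

definition occurs_at :: "letter list \<Rightarrow> (int \<Rightarrow> letter) \<Rightarrow> int \<Rightarrow> bool" where
  "occurs_at w \<omega> i \<longleftrightarrow> (\<forall>j<length w. \<omega> (i + 1 + int j) = w ! j)"

lemma stationary_occurs_at: "stationary (occurs_at w)"
  by (simp add: stationary_def occurs_at_def algebra_simps)

lemma mem_cylinder_iff: "\<omega> \<in> cylinder [] w \<longleftrightarrow> \<omega> \<in> Omega \<and> occurs_at w \<omega> 0"
proof -
  have "map \<omega> [1..int (length w)] = w \<longleftrightarrow> occurs_at w \<omega> 0"
    unfolding occurs_at_def list_eq_iff_nth_eq by simp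
  then show ?thesis by (simp add: cylinder_def)
qed

lemma delta_cylinder: "delta (cylinder [] w) = orbit_map (\<lambda>\<omega>. swap_at (occurs_at w \<omega>))"
proof
  fix \<omega>
  show "delta (cylinder [] w) \<omega> = orbit_map (\<lambda>\<omega>. swap_at (occurs_at w \<omega>)) \<omega>"
  proof (cases "\<omega> \<in> Omega")
    case True
    have "\<omega> \<in> Shift ` cylinder [] w \<longleftrightarrow> translate (- 1) \<omega> \<in> cylinder [] w"
    proof
      assume "translate (- 1) \<omega> \<in> cylinder [] w"
      moreover have "\<omega> = Shift (translate (- 1) \<omega>)" using True by (simp add: Shift_eq_translate)
      ultimately show "\<omega> \<in> Shift ` cylinder [] w" by blast
    qed (auto simp: mem_cylinder_iff Shift_eq_translate)
    moreover have "occurs_at w (translate (- 1) \<omega>) 0 = occurs_at w \<omega> (- 1)"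
      using stationary_occurs_at[of w] True by (simp add: stationary_def)
    moreover have "inv_into Omega Shift \<omega> = translate (- 1) \<omega>"
      using True Shift_Bij
      by (intro inv_into_f_eq) (auto simp: Bij_def bij_betw_def Shift_eq_translate)
    ultimately show ?thesis
      using True by (simp add: delta_def orbit_map_def swap_at_def mem_cylinder_iff Shift_eq_translate)
  qed (simp add: delta_def orbit_map_def)
qed

definition gens :: "((int \<Rightarrow> letter) \<Rightarrow> int \<Rightarrow> letter) set" where
  "gens = {Shift, delta (cylinder [] [LB]), delta (cylinder [] [LD]),
           delta (cylinder [] [LA, LC, LA, LC, LA, LC])}"

lemma orbit_map_id: "orbit_map (\<lambda>_. id) = (\<lambda>\<omega>\<in>Omega. \<omega>)"
  by (simp add: orbit_map_def)

lemma delta_cylinder_in_full_group: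
  assumes "\<And>\<omega>. \<omega> \<in> Omega \<Longrightarrow> spaced 1 (occurs_at w \<omega>)"
  shows "delta (cylinder [] w) \<in> full_group_carrier Omega_top Shift"
proof -
  let ?\<phi> = "\<lambda>\<omega>. swap_at (occurs_at w \<omega>)"
  have eq: "equivariant ?\<phi>" by (rule equivariant_swap_at[OF stationary_occurs_at])
  have "compose Omega (orbit_map ?\<phi>) (orbit_map ?\<phi>) = orbit_map (\<lambda>_. id)"
    unfolding compose_orbit_map[OF eq] using swap_at_involution[OF assms]
    by (auto simp: orbit_map_def cong: restrict_cong)
  then have inv: "orbit_map ?\<phi> (orbit_map ?\<phi> \<omega>) = \<omega>" if "\<omega> \<in> Omega" for \<omega>
  proof -
    have "compose Omega (orbit_map ?\<phi>) (orbit_map ?\<phi>) \<omega> = orbit_map (\<lambda>_. id) \<omega>"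
      by (simp only: \<open>compose Omega (orbit_map ?\<phi>) (orbit_map ?\<phi>) = orbit_map (\<lambda>_. id)\<close>)
    then show ?thesis using that by (simp add: compose_eq orbit_map_id)
  qed
  have "orbit_map ?\<phi> ` Omega \<subseteq> Omega" by (auto simp: orbit_map_def)
  then have "bij_betw (orbit_map ?\<phi>) Omega Omega"
    using inv by (intro bij_betw_byWitness[where f' = "orbit_map ?\<phi>"]) auto
  then have "orbit_map ?\<phi> \<in> Bij Omega" by (simp add: Bij_def orbit_map_def)
  moreover have "windowed (int (length w) + 1) (\<lambda>\<omega>. ?\<phi> \<omega> 0)"
    unfolding windowed_def
  proof (intro ballI impI)
    fix \<omega> \<eta> :: "int \<Rightarrow> letter" assume *: "\<forall>j. \<bar>j\<bar> \<le> int (length w) + 1 \<longrightarrow> \<omega> j = \<eta> (j :: int)"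
    have "occurs_at w \<omega> 0 = occurs_at w \<eta> 0" "occurs_at w \<omega> (- 1) = occurs_at w \<eta> (- 1)"
      unfolding occurs_at_def using * by auto
    then show "?\<phi> \<omega> 0 = ?\<phi> \<eta> 0" by (simp add: swap_at_def)
  qed
  moreover have "\<forall>\<omega>\<in>Omega. orbit_map ?\<phi> \<omega> = translate (?\<phi> \<omega> 0) \<omega>"
    by (simp add: orbit_map_def)
  ultimately show ?thesis
    unfolding mem_full_group_carrier_iff delta_cylinder by blast
qed

text \<open>No letter is doubled, since centers of level 1 alternate with positions carrying
  \<open>LA\<close>. Comparing first letters then excludes occurrences at adjacent
  positions.\<close>

lemma spaced_occurs_at:
  assumes "\<omega> \<in> Omega" "w \<noteq> []"
  shows "spaced 1 (occurs_at w \<omega>)"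
  unfolding spaced_def
proof (intro allI impI)
  fix b b' assume *: "occurs_at w \<omega> b" "occurs_at w \<omega> b'" "b \<noteq> b'"
  have "0 < length w" using assms(2) by simp
  then have "\<omega> (b + 1 + int 0) = \<omega> (b' + 1 + int 0)"
    using *(1,2) unfolding occurs_at_def by metis
  then have eq: "\<omega> (b + 1) = \<omega> (b' + 1)" by simp
  have "\<omega> i \<noteq> \<omega> (i + 1)" for i
  proof -
    obtain p where p: "center 1 \<omega> p" using center_exists[OF assms(1)] .
    have "center 1 \<omega> i \<longleftrightarrow> \<not> center 1 \<omega> (i + 1)"
      using center_iff[OF assms(1) p] by simp
    then show ?thesis using center_1_iff[OF assms(1)] by metis
  qed
  then have "b' \<noteq> b + 1" "b \<noteq> b' + 1" using eq by metis+
  then show "1 < \<bar>b - b'\<bar>" using *(3) by linarith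
qed

lemma gens_subset: "gens \<subseteq> full_group_carrier Omega_top Shift"
proof -
  have "windowed 0 (\<lambda>_. 1 :: int)" by (simp add: windowed_def)
  then have "Shift \<in> full_group_carrier Omega_top Shift"
    unfolding mem_full_group_carrier_iff using Shift_Bij Shift_eq_translate by blast
  then show ?thesis
    unfolding gens_def by (auto intro!: delta_cylinder_in_full_group spaced_occurs_at)
qed

lemma gens_subset_Bij: "gens \<subseteq> carrier (BijGroup Omega)"
  using gens_subset subgroup.subset[OF subgroup_full_group_carrier] by blast

section \<open>Families realized by the generated subgroup\<close>

definition realized :: "((int \<Rightarrow> letter) \<Rightarrow> int \<Rightarrow> int) \<Rightarrow> bool" where
  "realized \<phi> \<longleftrightarrow> equivariant \<phi> \<and> orbit_map \<phi> \<in> generate (BijGroup Omega) gens"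

lemma realized_comp:
  assumes "realized \<phi>" "realized \<psi>"
  shows "realized (\<lambda>\<omega>. \<phi> \<omega> \<circ> \<psi> \<omega>)"
proof -
  interpret group "BijGroup Omega" by (rule group_BijGroup)
  have "orbit_map \<phi> \<in> Bij Omega" "orbit_map \<psi> \<in> Bij Omega"
    using assms generate_in_carrier[OF gens_subset_Bij] by (simp_all add: realized_def BijGroup_simps)
  then have "orbit_map \<phi> \<otimes>\<^bsub>BijGroup Omega\<^esub> orbit_map \<psi> = orbit_map (\<lambda>\<omega>. \<phi> \<omega> \<circ> \<psi> \<omega>)"
    using assms(1) by (simp add: BijGroup_simps compose_orbit_map realized_def)
  then show ?thesis
    using assms generate.eng[of "orbit_map \<phi>" "BijGroup Omega" gens "orbit_map \<psi>"] equivariant_comp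
    by (simp add: realized_def)
qed

lemma realized_cong:
  assumes "realized \<phi>" "\<And>\<omega>. \<omega> \<in> Omega \<Longrightarrow> \<phi> \<omega> = \<psi> \<omega>"
  shows "realized \<psi>"
proof -
  have "orbit_map \<phi> = orbit_map \<psi>" using assms(2) by (auto simp: orbit_map_def cong: restrict_cong)
  moreover have "equivariant \<psi>" using assms by (simp add: realized_def equivariant_def)
  ultimately show ?thesis using assms(1) by (simp add: realized_def)
qed

lemma realized_shift: "realized (\<lambda>_ i. i + k)"
proof -
  interpret group "BijGroup Omega" by (rule group_BijGroup)
  have Sh: "Shift \<in> generate (BijGroup Omega) gens"
    by (rule generate.incl) (simp add: gens_def)
  have "orbit_map (\<lambda>_ i. i + k) = Shift [^]\<^bsub>BijGroup Omega\<^esub> k"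
    by (simp add: Shift_int_pow orbit_map_def)
  also have "\<dots> \<in> generate (BijGroup Omega) gens"
    by (rule subgroup_int_pow_closed[OF generate_is_subgroup[OF gens_subset_Bij] Sh])
  finally show ?thesis by (simp add: realized_def equivariant_def)
qed

lemma realized_id: "realized (\<lambda>_. id)"
  using realized_shift[of 0] by (simp add: id_def)

lemma realized_conj_shift:
  assumes "realized \<phi>"
  shows "realized (\<lambda>\<omega> i. \<phi> \<omega> (i + k) - k)"
  using realized_comp[OF realized_comp[OF realized_shift[of "- k"] assms] realized_shift[of k]]
  by (simp add: o_def)

lemma realized_swap_at_shift:
  assumes "realized (\<lambda>\<omega>. swap_at (u \<omega>))"
  shows "realized (\<lambda>\<omega>. swap_at (\<lambda>i. u \<omega> (i + k)))"
  by (rule realized_cong[OF realized_conj_shift[OF assms, of k]]) (auto simp: swap_at_def algebra_simps)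

lemma realized_swap_at_delta:
  "delta (cylinder [] w) \<in> gens \<Longrightarrow> realized (\<lambda>\<omega>. swap_at (occurs_at w \<omega>))"
  using equivariant_swap_at[OF stationary_occurs_at]
  by (auto simp: realized_def delta_cylinder[symmetric] intro: generate.incl)

section \<open>Permuting the levels of marked blocks\<close>

lemma transpose_Suc_conj:
  fixes a b :: int
  assumes "a < b"
  shows "Transposition.transpose a (b + 1) = Transposition.transpose b (b + 1) \<circ> (Transposition.transpose a b \<circ> Transposition.transpose b (b + 1))"
  using assms by (auto simp: Transposition.transpose_def fun_eq_iff)

text \<open>Translates of the swap over \<open>u\<close> are the adjacent transpositions of levels,
  and these generate all permutations of \<open>{0..L}\<close>: conjugation stretches a
  transposition step by step.\<close>

lemma realized_block_perm_const:
  assumes c: "stationary c" "\<And>\<omega>. \<omega> \<in> Omega \<Longrightarrow> spaced L (c \<omega>)"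
    and u: "\<And>\<omega> b. \<omega> \<in> Omega \<Longrightarrow> u \<omega> b \<Longrightarrow> c \<omega> b" "realized (\<lambda>\<omega>. swap_at (u \<omega>))"
    and s: "s permutes {0..L}"
  shows "realized (\<lambda>\<omega>. block_perm L (c \<omega>) (\<lambda>b. if u \<omega> b then s else id))" (is "?P s")
proof -
  have id: "?P id"
    by (rule realized_cong[OF realized_id]) (simp only: if_cancel block_perm_id[OF c(2)])
  have comp: "?P (s \<circ> t)" if "?P s" "?P t" "t permutes {0..L}" for s t
  proof (rule realized_cong[OF realized_comp[OF that(1,2)]])
    fix \<omega> assume \<omega>: "\<omega> \<in> Omega"
    show "block_perm L (c \<omega>) (\<lambda>b. if u \<omega> b then s else id) \<circ> block_perm L (c \<omega>) (\<lambda>b. if u \<omega> b then t else id)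
        = block_perm L (c \<omega>) (\<lambda>b. if u \<omega> b then s \<circ> t else id)"
      by (subst block_perm_comp[OF c(2)[OF \<omega>]])
        (auto simp: that(3) permutes_id intro!: block_perm_cong[OF c(2)[OF \<omega>]])
  qed
  have adj: "?P (Transposition.transpose j (j + 1))" if "0 \<le> j" "j < L" for j
    by (rule realized_cong[OF realized_swap_at_shift[OF u(2), of "- j"]])
      (use swap_at_eq_block_perm[OF c(2) that] u(1) in simp)
  have tr: "?P (Transposition.transpose a (a + 1 + int d))" if "0 \<le> a" "a + 1 + int d \<le> L" for a d
    using that
  proof (induction d)
    case 0
    then show ?case using adj[of a] by (simp cong: if_cong)
  next
    case (Suc d)
    let ?b = "a + 1 + int d"
    have "?P (Transposition.transpose ?b (?b + 1))" using Suc.prems by (intro adj) auto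
    moreover have "?P (Transposition.transpose a ?b)" using Suc by simp
    moreover have "Transposition.transpose ?b (?b + 1) permutes {0..L}" "Transposition.transpose a ?b permutes {0..L}"
      using Suc.prems by (auto intro!: permutes_swap_id)
    ultimately have "?P (Transposition.transpose ?b (?b + 1) \<circ> (Transposition.transpose a ?b \<circ> Transposition.transpose ?b (?b + 1)))"
      by (intro comp permutes_compose)
    then show ?case using transpose_Suc_conj[of a ?b] by (simp add: algebra_simps cong: if_cong)
  qed
  have tr': "?P (Transposition.transpose a b)" if "a \<in> {0..L}" "b \<in> {0..L}" for a b
  proof (cases a b rule: linorder_cases)
    case less
    then show ?thesis using tr[of a "nat (b - a - 1)"] that by (simp cong: if_cong)
  next
    case equal
    then show ?thesis using id by (simp only: transpose_same)
  next
    case greater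
    then show ?thesis using tr[of b "nat (a - b - 1)"] that
      by (simp add: Transposition.transpose_commute[of a b] cong: if_cong)
  qed
  have "finite {0..L}" by simp
  with s show ?thesis
    by (induction rule: permutes_induct) (use id comp tr' in blast)+
qed

text \<open>For \<open>u\<close> with \<open>spaced 2\<close> these are the two mutually inverse
  3-cycles of the levels 0, 1, 2 over \<open>u\<close>. Both are kept because a commutator uses a
  cycle and its inverse.\<close>

definition cycles_realized :: "((int \<Rightarrow> letter) \<Rightarrow> int \<Rightarrow> bool) \<Rightarrow> bool" where
  "cycles_realized u \<longleftrightarrow>
     realized (\<lambda>\<omega>. swap_at (u \<omega>) \<circ> swap_at (\<lambda>i. u \<omega> (i - 1))) \<and>
     realized (\<lambda>\<omega>. swap_at (\<lambda>i. u \<omega> (i - 1)) \<circ> swap_at (u \<omega>))"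

lemma cycles_realized_swap:
  assumes "realized (\<lambda>\<omega>. swap_at (u \<omega>))"
  shows "cycles_realized u"
  using realized_swap_at_shift[OF assms, of "- 1"] assms
  by (simp add: cycles_realized_def realized_comp)

text \<open>A commutator of a 3-cycle over \<open>u\<close> with the swap over \<open>v\<close>
  survives only where both sets meet. The outcome is again a pair of 3-cycles, so further sets can
  be intersected.\<close>

lemma cycles_realized_conj:
  assumes "cycles_realized u" "realized (\<lambda>\<omega>. swap_at (v \<omega>))"
    and "\<And>\<omega>. \<omega> \<in> Omega \<Longrightarrow> spaced 2 (c \<omega>)"
    and "\<And>\<omega> b. \<omega> \<in> Omega \<Longrightarrow> u \<omega> b \<Longrightarrow> c \<omega> b" "\<And>\<omega> b. \<omega> \<in> Omega \<Longrightarrow> v \<omega> b \<Longrightarrow> c \<omega> b"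
  shows "cycles_realized (\<lambda>\<omega> i. u \<omega> i \<and> v \<omega> i)"
proof -
  note cyc = assms(1)[unfolded cycles_realized_def, THEN conjunct1]
    assms(1)[unfolded cycles_realized_def, THEN conjunct2]
  have sub: "\<forall>b. u \<omega> b \<longrightarrow> c \<omega> b" "\<forall>b. v \<omega> b \<longrightarrow> c \<omega> b" if "\<omega> \<in> Omega" for \<omega>
    using assms(4,5) that by blast+
  note conj = swap_at_cycle_conj[OF assms(3) sub]
  show ?thesis
    unfolding cycles_realized_def
    by (intro conjI realized_cong[OF realized_comp[OF realized_comp[OF realized_comp[OF assms(2) cyc(1)] assms(2)] cyc(2)]]
      realized_cong[OF realized_comp[OF realized_comp[OF realized_comp[OF cyc(1) assms(2)] cyc(2)] assms(2)]])
     (simp_all only: conj)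
qed

text \<open>The product is a chain of swaps over consecutive translates of \<open>u\<close>, each
  inner swap appearing twice and cancelling. Every link is a translate of the first map in
  \<open>cycles_realized u\<close>.\<close>

lemma cycles_realized_telescope:
  assumes "cycles_realized u" "\<And>\<omega>. \<omega> \<in> Omega \<Longrightarrow> spaced 1 (u \<omega>)"
  shows "realized (\<lambda>\<omega>. swap_at (u \<omega>) \<circ> swap_at (\<lambda>i. u \<omega> (i - int k)))"
proof (induction k)
  case 0
  show ?case
    by (rule realized_cong[OF realized_id]) (use swap_at_involution[OF assms(2)] in \<open>simp add: id_def\<close>)
next
  case (Suc k)
  have "realized (\<lambda>\<omega>. swap_at (u \<omega>) \<circ> swap_at (\<lambda>i. u \<omega> (i - 1)))"
    using assms(1) by (simp add: cycles_realized_def)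
  note realized_comp[OF Suc realized_conj_shift[OF this, of "- int k"]]
  then show ?case
  proof (rule realized_cong)
    fix \<omega> assume \<omega>: "\<omega> \<in> Omega"
    have sp: "spaced 1 (\<lambda>i. u \<omega> (i - int k))"
      using spaced_shift[OF assms(2)[OF \<omega>], of "- int k"] by simp
    have "(\<lambda>i. (swap_at (u \<omega>) \<circ> swap_at (\<lambda>i. u \<omega> (i - 1))) (i + - int k) - - int k)
        = swap_at (\<lambda>i. u \<omega> (i - int k)) \<circ> swap_at (\<lambda>i. u \<omega> (i - int (Suc k)))"
      by (auto simp: swap_at_def algebra_simps)
    then show "swap_at (u \<omega>) \<circ> swap_at (\<lambda>i. u \<omega> (i - int k)) \<circ>
        (\<lambda>i. (swap_at (u \<omega>) \<circ> swap_at (\<lambda>i. u \<omega> (i - 1))) (i + - int k) - - int k)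
        = swap_at (u \<omega>) \<circ> swap_at (\<lambda>i. u \<omega> (i - int (Suc k)))"
      using swap_at_involution[OF sp] by (metis comp_assoc comp_id)
  qed
qed

section \<open>Descending through the levels\<close>

definition marked :: "nat \<Rightarrow> letter \<Rightarrow> (int \<Rightarrow> letter) \<Rightarrow> int \<Rightarrow> bool" where
  "marked n x \<omega> i \<longleftrightarrow> center n \<omega> i \<and> \<omega> i = x"

lemma stationary_center: "stationary (center n)"
  by (simp add: stationary_def)

lemma spaced_center:
  assumes "\<omega> \<in> Omega" "L < 2 ^ n"
  shows "spaced L (center n \<omega>)"
  unfolding spaced_def
proof (intro allI impI)
  fix b b' assume "center n \<omega> b" "center n \<omega> b'" "b \<noteq> b'"
  then have "\<not> \<bar>b - b'\<bar> < 2 ^ n" using center_dist[OF assms(1)] by blast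
  then show "L < \<bar>b - b'\<bar>" using assms(2) by linarith
qed

lemma spaced_marked: "\<omega> \<in> Omega \<Longrightarrow> L < 2 ^ n \<Longrightarrow> spaced L (marked n x \<omega>)"
  by (rule spaced_mono[OF spaced_center]) (auto simp: marked_def)

text \<open>A center that is lost at level \<open>n + 1\<close> carries \<open>toep n\<close>, so
  the sets of the other letters lose nothing.\<close>

lemma marked_Suc_other:
  "\<omega> \<in> Omega \<Longrightarrow> x \<noteq> toep n \<Longrightarrow> marked (Suc n) x \<omega> i \<longleftrightarrow> marked n x \<omega> i"
  using center_Suc_shift(3)[of \<omega> n i] center_mono[of "Suc n" \<omega> i n] by (auto simp: marked_def)

lemma center_shift_multiple:
  assumes "center n \<omega> p"
  shows "center n \<omega> (p + 2 ^ n)" "center n \<omega> (p - 2 ^ n)"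
  by (rule center_shift[OF assms]; simp)+

lemma center_Suc_neighbours:
  assumes "center (Suc n) \<omega> i"
  shows "\<omega> (i + 2 ^ n) = toep n" "\<omega> (i - 2 ^ n) = toep n"
proof -
  have "\<omega> (i + 2 ^ n * (2 * t + 1)) = toep n" for t
    using assms unfolding center_Suc by blast
  from this[of 0] this[of "- 1"] show "\<omega> (i + 2 ^ n) = toep n" "\<omega> (i - 2 ^ n) = toep n" by simp_all
qed

text \<open>If \<open>i\<close> were not a center of level \<open>n + 1\<close>, then
  \<open>i - 2 ^ n\<close> and \<open>i + 2 ^ n\<close> would be consecutive such centers, and one
  of them would carry \<open>toep (Suc n)\<close>. An intersection of translates is a form that
  commutators can reach.\<close>

lemma marked_toep_neighbours:
  assumes "\<omega> \<in> Omega"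
  shows "marked n (toep n) \<omega> i \<and> marked n (toep n) \<omega> (i + 2 ^ n) \<and> marked n (toep n) \<omega> (i - 2 ^ n)
    \<longleftrightarrow> marked (Suc n) (toep n) \<omega> i" (is "?l \<longleftrightarrow> ?r")
proof
  assume ?r
  then show ?l
    using center_Suc_neighbours[of n \<omega> i] center_mono[of "Suc n" \<omega> i n] center_shift_multiple[of n \<omega> i]
    by (simp add: marked_def)
next
  assume l: ?l
  have "center (Suc n) \<omega> i"
  proof (rule ccontr)
    assume "\<not> center (Suc n) \<omega> i"
    then have c: "center (Suc n) \<omega> (i + 2 ^ n)" "center (Suc n) \<omega> (i - 2 ^ n)"
      using l center_Suc_shift[OF assms, of n i] by (simp_all add: marked_def)
    have "i - 2 ^ n + 2 ^ Suc n = i + 2 ^ n" by simp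
    then have "\<not> center (Suc (Suc n)) \<omega> (i - 2 ^ n) \<or> \<not> center (Suc (Suc n)) \<omega> (i + 2 ^ n)"
      using center_Suc_shift(1)[OF assms c(2)] by metis
    then have "\<omega> (i - 2 ^ n) = toep (Suc n) \<or> \<omega> (i + 2 ^ n) = toep (Suc n)"
      using center_Suc_shift(3)[OF assms] c by blast
    then show False using l toep_Suc_neq[of n] by (auto simp: marked_def)
  qed
  then show ?r using l by (simp add: marked_def)
qed

lemma marked_cases:
  assumes "\<omega> \<in> Omega" "n > 0" "m > 0"
  shows "center n \<omega> i \<longleftrightarrow>
    marked n (toep m) \<omega> i \<or> marked n (toep (Suc m)) \<omega> i \<or> marked n (toep (Suc (Suc m))) \<omega> i"
  using center_letter[OF assms(1) _ assms(2), of i] toep_cases[OF assms(3), of "\<omega> i"]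
  by (auto simp: marked_def)

text \<open>The second alternative describes the centers that drop out: they are the translates by
  \<open>2 ^ n\<close> of those that remain.\<close>

lemma marked_toep_split:
  assumes "\<omega> \<in> Omega"
  shows "marked n (toep n) \<omega> i \<longleftrightarrow> marked (Suc n) (toep n) \<omega> i \<or> center (Suc n) \<omega> (i - 2 ^ n)"
proof
  assume l: "marked n (toep n) \<omega> i"
  then show "marked (Suc n) (toep n) \<omega> i \<or> center (Suc n) \<omega> (i - 2 ^ n)"
    using center_Suc_shift(2)[OF assms, of n i] by (auto simp: marked_def)
next
  assume r: "marked (Suc n) (toep n) \<omega> i \<or> center (Suc n) \<omega> (i - 2 ^ n)"
  then show "marked n (toep n) \<omega> i"
  proof
    assume "center (Suc n) \<omega> (i - 2 ^ n)"
    then show ?thesis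
      using center_Suc_neighbours(1)[of n \<omega> "i - 2 ^ n"]
        center_shift_multiple(1)[OF center_mono[of "Suc n" \<omega> "i - 2 ^ n" n]]
      by (simp add: marked_def)
  qed (use center_mono[of "Suc n" \<omega> i n] in \<open>simp add: marked_def\<close>)
qed

lemma center_Suc_exclusive:
  assumes "\<omega> \<in> Omega" "center (Suc n) \<omega> i" "center (Suc n) \<omega> (i - 2 ^ n)"
  shows False
  using center_Suc_shift(2)[OF assms(1) center_mono[OF assms(2)], of n] assms(2,3) by simp

text \<open>Translating the transposition on \<open>marked (Suc m) (toep m)\<close> by \<open>2 ^ m\<close> costs only 3-cycles on
  that set, which commutators provide. Hence the transposition on \<open>marked m (toep m)\<close> can be traded
  for the missing one on \<open>marked m (toep n)\<close>, where \<open>m = Suc n\<close>.\<close>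

lemma realized_marked_Suc:
  assumes n: "n \<ge> 2" and IH: "\<And>x. x \<noteq> LA \<Longrightarrow> realized (\<lambda>\<omega>. swap_at (marked n x \<omega>))" and x: "x \<noteq> LA"
  shows "realized (\<lambda>\<omega>. swap_at (marked (Suc n) x \<omega>))"
proof (cases "x = toep n")
  case False
  have "marked n x \<omega> = marked (Suc n) x \<omega>" if "\<omega> \<in> Omega" for \<omega>
    using marked_Suc_other[OF that False] by blast
  then show ?thesis by (intro realized_cong[OF IH[OF x]]) simp
next
  case True
  \<comment> \<open>Between levels \<open>n\<close> and \<open>m\<close> only \<open>x\<close> loses
    centers, so the swaps for \<open>y\<close> and \<open>z\<close> carry over. At level
    \<open>m + 1\<close> the letter that loses centers is \<open>y\<close>, so \<open>z\<close>
    survives this step too.\<close>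
  define m where "m = Suc n"
  define M where "M = (2 :: int) ^ m"
  define y where "y = toep m"
  define z where "z = toep (Suc m)"
  have ne: "y \<noteq> LA" "z \<noteq> LA" "y \<noteq> x" "z \<noteq> x" "y \<noteq> z"
    using toep_distinct[of n] n True by (auto simp: y_def z_def m_def toep_eq_LA_iff)
  \<comment> \<open>\<open>toep\<close> has period 3 from index 1 on, so the letter
    \<open>toep n\<close> returns at index \<open>n + 3\<close>.\<close>
  have x_eq: "x = toep (Suc (Suc m))" if "x \<noteq> LA"
    using toep_cases[of m x] that ne(3,4) by (auto simp: y_def z_def m_def)
  have M: "M \<ge> 8"
  proof -
    have "(2 :: int) ^ 3 \<le> 2 ^ m" using n by (intro power_increasing) (auto simp: m_def)
    then show ?thesis by (simp add: M_def)
  qed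
  have marked_n: "marked m w \<omega> = marked n w \<omega>" if "\<omega> \<in> Omega" "w \<noteq> x" for w \<omega>
    using marked_Suc_other[OF that(1), of w n] that(2) True by (auto simp: m_def)
  have Ry: "realized (\<lambda>\<omega>. swap_at (marked m y \<omega>))"
    by (rule realized_cong[OF IH[OF ne(1)]]) (simp add: marked_n ne)
  have Rz: "realized (\<lambda>\<omega>. swap_at (marked (Suc m) z \<omega>))"
  proof (rule realized_cong[OF IH[OF ne(2)]])
    fix \<omega> assume \<omega>: "\<omega> \<in> Omega"
    have "marked (Suc m) z \<omega> = marked m z \<omega>"
      using marked_Suc_other[OF \<omega>, of z m] ne(5) by (auto simp: y_def)
    then show "swap_at (marked n z \<omega>) = swap_at (marked (Suc m) z \<omega>)"
      using marked_n[OF \<omega>] ne(4) by simp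
  qed
  have sp: "spaced 2 (center m \<omega>)" if "\<omega> \<in> Omega" for \<omega>
    using spaced_center[OF that] M by (simp add: M_def)
  \<comment> \<open>Intersecting with the translates by \<open>M\<close> and \<open>- M\<close>
    leaves exactly \<open>marked (Suc m) y\<close>, by
    \<open>marked_toep_neighbours\<close>.\<close>
  have c1: "cycles_realized (\<lambda>\<omega> i. marked m y \<omega> i \<and> marked m y \<omega> (i + M))"
  proof (rule cycles_realized_conj[OF cycles_realized_swap[OF Ry] realized_swap_at_shift[OF Ry] sp])
    fix \<omega> b assume "marked m y \<omega> (b + M)"
    then show "center m \<omega> b"
      using center_shift_multiple(2)[of m \<omega> "b + M"] by (simp add: marked_def M_def)
  qed (auto simp: marked_def)
  have c2: "cycles_realized (\<lambda>\<omega> i. (marked m y \<omega> i \<and> marked m y \<omega> (i + M)) \<and> marked m y \<omega> (i + - M))"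
  proof (rule cycles_realized_conj[OF c1 realized_swap_at_shift[OF Ry] sp])
    fix \<omega> b assume "marked m y \<omega> (b + - M)"
    then show "center m \<omega> b"
      using center_shift_multiple(1)[of m \<omega> "b - M"] by (simp add: marked_def M_def)
  qed (auto simp: marked_def)
  define u where "u \<omega> i \<longleftrightarrow> (marked m y \<omega> i \<and> marked m y \<omega> (i + M)) \<and> marked m y \<omega> (i + - M)" for \<omega> i
  have u: "u \<omega> i \<longleftrightarrow> marked (Suc m) y \<omega> i" if "\<omega> \<in> Omega" for \<omega> i
    using marked_toep_neighbours[OF that, of m i] by (simp add: u_def y_def M_def)
  define e where "e \<omega> i \<longleftrightarrow> u \<omega> i \<or> u \<omega> (i - M)" for \<omega> i
  define z' where "z' \<omega> i \<longleftrightarrow> marked (Suc m) z \<omega> (i - M)" for \<omega> i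
  define x' where "x' \<omega> i \<longleftrightarrow> marked (Suc m) x \<omega> (i - M)" for \<omega> i
  \<comment> \<open>Besides \<open>u\<close>, the set consists of the centers of level
    \<open>m + 1\<close> translated by \<open>M\<close>, sorted by their letters: \<open>y\<close>
    gives \<open>u\<close> again, \<open>z\<close> and \<open>x\<close> give the other two
    parts.\<close>
  have split: "marked m y \<omega> i \<longleftrightarrow> e \<omega> i \<or> z' \<omega> i \<or> x' \<omega> i" if "\<omega> \<in> Omega" for \<omega> i
  proof -
    have "center (Suc m) \<omega> (i - M) \<longleftrightarrow>
        marked (Suc m) y \<omega> (i - M) \<or> marked (Suc m) z \<omega> (i - M) \<or> marked (Suc m) x \<omega> (i - M)"
      using marked_cases[OF that, of "Suc m" m "i - M"] x_eq[OF x] by (simp add: y_def z_def m_def)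
    then show ?thesis
      using marked_toep_split[OF that, of m i] unfolding e_def z'_def x'_def u[OF that] y_def M_def by blast
  qed
  have disj: "\<not> (u \<omega> i \<and> center (Suc m) \<omega> (i - M))" if "\<omega> \<in> Omega" for \<omega> i
    using center_Suc_exclusive[OF that, of m i] u[OF that] by (auto simp: marked_def M_def)
  have sp1: "spaced 1 (marked m y \<omega>)" if "\<omega> \<in> Omega" for \<omega>
    using spaced_marked[OF that, of 1 m] M by (simp add: M_def)
  have spe: "spaced 1 (e \<omega>)" "spaced 1 (\<lambda>i. z' \<omega> i \<or> x' \<omega> i)" "spaced 1 (z' \<omega>)"
    "spaced 1 (\<lambda>i. e \<omega> i \<or> z' \<omega> i \<or> x' \<omega> i)" "spaced 1 (u \<omega>)" if "\<omega> \<in> Omega" for \<omega>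
    by (rule spaced_mono[OF sp1[OF that]]; auto simp: split[OF that] e_def)+
  have "realized (\<lambda>\<omega>. swap_at (u \<omega>) \<circ> swap_at (\<lambda>i. u \<omega> (i - int (nat M))))"
    by (rule cycles_realized_telescope) (use c2 spe in \<open>simp_all add: u_def[abs_def]\<close>)
  then have Re: "realized (\<lambda>\<omega>. swap_at (e \<omega>))"
  proof (rule realized_cong)
    fix \<omega> assume \<omega>: "\<omega> \<in> Omega"
    have "swap_at (e \<omega>) = swap_at (u \<omega>) \<circ> swap_at (\<lambda>i. u \<omega> (i - M))"
      unfolding e_def
    proof (rule swap_at_disj)
      show "spaced 1 (\<lambda>i. u \<omega> i \<or> u \<omega> (i - M))" using spe(1)[OF \<omega>] by (simp add: e_def[abs_def])
      fix i assume "u \<omega> i" "u \<omega> (i - M)"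
      then show False using disj[OF \<omega>, of i] u[OF \<omega>] by (auto simp: marked_def)
    qed
    then show "swap_at (u \<omega>) \<circ> swap_at (\<lambda>i. u \<omega> (i - int (nat M))) = swap_at (e \<omega>)"
      using M by simp
  qed
  have Rz': "realized (\<lambda>\<omega>. swap_at (z' \<omega>))"
    using realized_swap_at_shift[OF Rz, of "- M"] by (simp add: z'_def[abs_def])
  \<comment> \<open>Of the three disjoint parts of \<open>marked m y\<close>, two have realized
    swaps; these are involutions, so they can be cancelled on the left.\<close>
  have "realized (\<lambda>\<omega>. swap_at (x' \<omega>))"
  proof (rule realized_cong[OF realized_comp[OF realized_comp[OF Rz' Re] Ry]])
    fix \<omega> assume \<omega>: "\<omega> \<in> Omega"
    have "swap_at (marked m y \<omega>) = swap_at (\<lambda>i. e \<omega> i \<or> z' \<omega> i \<or> x' \<omega> i)"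
      using split[OF \<omega>] by (intro arg_cong[where f = swap_at]) blast
    also have "\<dots> = swap_at (e \<omega>) \<circ> swap_at (\<lambda>i. z' \<omega> i \<or> x' \<omega> i)"
    proof (rule swap_at_disj[OF spe(4)[OF \<omega>]])
      fix i assume e: "e \<omega> i" and zx: "z' \<omega> i \<or> x' \<omega> i"
      then have "center (Suc m) \<omega> (i - M)" "\<omega> (i - M) \<noteq> y"
        using ne by (auto simp: z'_def x'_def marked_def)
      then show False using e disj[OF \<omega>, of i] u[OF \<omega>] by (auto simp: e_def marked_def)
    qed
    also have "swap_at (\<lambda>i. z' \<omega> i \<or> x' \<omega> i) = swap_at (z' \<omega>) \<circ> swap_at (x' \<omega>)"
      by (rule swap_at_disj[OF spe(2)[OF \<omega>]]) (use ne in \<open>auto simp: z'_def x'_def marked_def\<close>)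
    finally show "swap_at (z' \<omega>) \<circ> swap_at (e \<omega>) \<circ> swap_at (marked m y \<omega>) = swap_at (x' \<omega>)"
      using swap_at_involution[OF spe(1)[OF \<omega>]] swap_at_involution[OF spe(3)[OF \<omega>]]
      by (metis comp_assoc id_comp)
  qed
  from realized_swap_at_shift[OF this, of M]
  have "realized (\<lambda>\<omega>. swap_at (marked (Suc m) x \<omega>))" by (simp add: x'_def)
  then show ?thesis
  proof (rule realized_cong)
    fix \<omega> assume "\<omega> \<in> Omega"
    then have "marked (Suc m) x \<omega> = marked m x \<omega>"
      using marked_Suc_other[of \<omega> x m] ne(3) by (auto simp: y_def)
    then show "swap_at (marked (Suc m) x \<omega>) = swap_at (marked (Suc n) x \<omega>)" by (simp add: m_def)
  qed
qed

section \<open>Level two: the given cylinders\<close>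

lemma occurs_at_single:
  assumes "\<omega> \<in> Omega" "x \<noteq> LA" "x \<noteq> LC"
  shows "occurs_at [x] \<omega> (i - 1) \<longleftrightarrow> marked 2 x \<omega> i"
proof -
  \<comment> \<open>From level 1 to level 2 only \<open>LC\<close> loses centers.\<close>
  have "marked 2 x \<omega> i \<longleftrightarrow> marked 1 x \<omega> i"
    unfolding Suc_1[symmetric] by (rule marked_Suc_other[OF assms(1)]) (use assms(3) in \<open>simp add: toep_def\<close>)
  then show ?thesis
    using center_1_iff[OF assms(1), of i] assms(2) by (auto simp: occurs_at_def marked_def)
qed

text \<open>The word puts \<open>LC\<close> at \<open>i - 2\<close>, \<open>i\<close> and
  \<open>i + 2\<close>, as in \<open>marked_toep_neighbours\<close> at level 1: if \<open>i\<close>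
  were not a center of level 2, one of the outer two would carry \<open>LB\<close>. The offset 4
  makes \<open>i\<close> the place of the fourth letter.\<close>

lemma occurs_at_acacac:
  assumes "\<omega> \<in> Omega"
  shows "occurs_at [LA, LC, LA, LC, LA, LC] \<omega> (i - 4) \<longleftrightarrow> marked 2 LC \<omega> i"
proof -
  have occ: "occurs_at [LA, LC, LA, LC, LA, LC] \<omega> (i - 4) \<longleftrightarrow>
    \<omega> (i - 3) = LA \<and> \<omega> (i - 2) = LC \<and> \<omega> (i - 1) = LA \<and> \<omega> i = LC \<and> \<omega> (i + 1) = LA \<and> \<omega> (i + 2) = LC"
  proof -
    have all: "(\<forall>j<length [LA, LC, LA, LC, LA, LC]. P j) \<longleftrightarrow> P 0 \<and> P 1 \<and> P 2 \<and> P 3 \<and> P 4 \<and> P 5"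
      for P :: "nat \<Rightarrow> bool"
      by (simp add: All_less_Suc numeral_eq_Suc conj_ac)
    show ?thesis unfolding occurs_at_def all by (simp add: add.commute)
  qed
  show ?thesis
  proof
    assume *: "marked 2 LC \<omega> i"
    then have c: "center (Suc 1) \<omega> i" "center (Suc 0) \<omega> i" and l: "\<omega> i = LC"
      using center_mono[of 2 \<omega> i "Suc 0"] by (simp_all add: marked_def numeral_2_eq_2)
    have "\<omega> (i + (2 * t + 1)) = LA" for t
      using c(2) unfolding center_Suc by (simp add: toep_def)
    from this[of 0] this[of "- 1"] this[of "- 2"] show "occurs_at [LA, LC, LA, LC, LA, LC] \<omega> (i - 4)"
      unfolding occ using l center_Suc_neighbours[OF c(1)] by (simp add: toep_def)
  next
    assume "occurs_at [LA, LC, LA, LC, LA, LC] \<omega> (i - 4)"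
    then have l: "\<omega> (i - 2) = LC" "\<omega> i = LC" "\<omega> (i + 2) = LC"
      by (simp_all add: occ)
    then have "center (Suc 0) \<omega> i" using center_1_iff[OF assms, of i] by simp
    have "center (Suc 1) \<omega> i"
    proof (rule ccontr)
      assume "\<not> center (Suc 1) \<omega> i"
      then have c: "center (Suc 1) \<omega> (i + 2)" "center (Suc 1) \<omega> (i - 2)"
        using center_Suc_shift[OF assms, of 1 i] \<open>center (Suc 0) \<omega> i\<close> by simp_all
      have "\<omega> (i - 2) \<noteq> toep 2" "\<omega> (i + 2) \<noteq> toep 2" using l by (simp_all add: toep_def)
      then show False
        using center_Suc_shift(1)[OF assms c(2)] center_Suc_shift(3)[OF assms c(1)]
          center_Suc_shift(3)[OF assms c(2)] center_Suc_exclusive[OF assms, of "Suc 1" "i + 2"]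
        by (auto simp: numeral_2_eq_2)
    qed
    then show "marked 2 LC \<omega> i" using l(2) by (simp add: marked_def numeral_2_eq_2)
  qed
qed

lemma realized_marked:
  assumes "n \<ge> 2" "x \<noteq> LA"
  shows "realized (\<lambda>\<omega>. swap_at (marked n x \<omega>))"
  using assms
proof (induction n arbitrary: x rule: dec_induct)
  case base
  have single: "realized (\<lambda>\<omega>. swap_at (marked 2 x \<omega>))"
    if "delta (cylinder [] [x]) \<in> gens" "x \<noteq> LA" "x \<noteq> LC" for x
  proof (rule realized_cong[OF realized_swap_at_shift[OF realized_swap_at_delta[OF that(1)], of "- 1"]])
    fix \<omega> assume "\<omega> \<in> Omega"
    then show "swap_at (\<lambda>i. occurs_at [x] \<omega> (i + - 1)) = swap_at (marked 2 x \<omega>)"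
      using occurs_at_single[OF _ that(2,3)] by (intro arg_cong[where f = swap_at]) auto
  qed
  have "realized (\<lambda>\<omega>. swap_at (marked 2 LC \<omega>))"
  proof (rule realized_cong[OF realized_swap_at_shift[OF realized_swap_at_delta, of _ "- 4"]])
    fix \<omega> assume "\<omega> \<in> Omega"
    then show "swap_at (\<lambda>i. occurs_at [LA, LC, LA, LC, LA, LC] \<omega> (i + - 4)) = swap_at (marked 2 LC \<omega>)"
      using occurs_at_acacac by (intro arg_cong[where f = swap_at]) auto
  qed (simp add: gens_def)
  then show ?case using single base by (cases x) (auto simp: gens_def)
next
  case (step n)
  then show ?case using realized_marked_Suc by blast
qed

text \<open>Blocks with different center letters are disjoint, so the permutations for the three
  letters can be applied in turn. The offset \<open>a\<close> fixes the place of the center in the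
  block; \<open>L = 2 ^ n - 1\<close> gives blocks that tile the line.\<close>

lemma realized_block_letters:
  assumes n: "n \<ge> 2" and L: "L < 2 ^ n" and s: "\<And>x. s x permutes {0..L}"
  shows "realized (\<lambda>\<omega>. block_perm L (\<lambda>b. center n \<omega> (b + a)) (\<lambda>b. s (\<omega> (b + a))))"
proof -
  let ?c = "\<lambda>\<omega> b. center n \<omega> (b + a)"
  let ?B = "\<lambda>x \<omega>. block_perm L (?c \<omega>) (\<lambda>b. if marked n x \<omega> (b + a) then s x else id)"
  have sp: "spaced L (?c \<omega>)" if "\<omega> \<in> Omega" for \<omega>
    by (rule spaced_shift[OF spaced_center[OF that L]])
  have R: "realized (?B x)" if "x \<noteq> LA" for x
    by (rule realized_block_perm_const[OF _ sp])
      (use realized_swap_at_shift[OF realized_marked[OF n that]] s stationary_shift[OF stationary_center]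
        in \<open>auto simp: marked_def\<close>)
  show ?thesis
  proof (rule realized_cong[OF realized_comp[OF realized_comp[OF R[of LB] R[of LC]] R[of LD]]])
    fix \<omega> assume \<omega>: "\<omega> \<in> Omega"
    have perm: "(if P then s x else id) permutes {0..L}" for P x
      using s by (simp add: permutes_id)
    have "?B LB \<omega> \<circ> ?B LC \<omega> \<circ> ?B LD \<omega> = block_perm L (?c \<omega>)
      (\<lambda>b. ((if marked n LB \<omega> (b + a) then s LB else id) \<circ> (if marked n LC \<omega> (b + a) then s LC else id))
        \<circ> (if marked n LD \<omega> (b + a) then s LD else id))"
      by (simp only: block_perm_comp[OF sp[OF \<omega>]] perm)
    also have "\<dots> = block_perm L (?c \<omega>) (\<lambda>b. s (\<omega> (b + a)))"
    proof (rule block_perm_cong[OF sp[OF \<omega>]])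
      fix b j assume c: "?c \<omega> b"
      then have "\<omega> (b + a) \<noteq> LA" using center_letter[OF \<omega>] n by simp
      then show "(((if marked n LB \<omega> (b + a) then s LB else id) \<circ> (if marked n LC \<omega> (b + a) then s LC else id))
        \<circ> (if marked n LD \<omega> (b + a) then s LD else id)) j = s (\<omega> (b + a)) j"
        using c by (cases "\<omega> (b + a)") (auto simp: marked_def)
    qed
    finally show "?B LB \<omega> \<circ> ?B LC \<omega> \<circ> ?B LD \<omega> = block_perm L (?c \<omega>) (\<lambda>b. s (\<omega> (b + a)))" .
  qed simp_all
qed

section \<open>Cutting an element into block permutations\<close>

lemma permutes_onto:
  assumes "finite S" "A \<subseteq> S" "B \<subseteq> S" "card A = card B"
  obtains \<rho> where "\<rho> permutes S" "\<rho> ` A = B"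
proof -
  have fin: "finite A" "finite B" using assms finite_subset by blast+
  obtain f where f: "bij_betw f A B" using finite_same_card_bij[OF fin assms(4)] by blast
  have "card (S - A) = card (S - B)" using assms fin by (simp add: card_Diff_subset)
  then obtain g where g: "bij_betw g (S - A) (S - B)"
    using finite_same_card_bij[of "S - A" "S - B"] assms(1) by auto
  define \<rho> where "\<rho> x = (if x \<in> A then f x else if x \<in> S then g x else x)" for x
  have A: "bij_betw \<rho> A B"
    using f by (rule bij_betw_cong[THEN iffD1, rotated]) (simp add: \<rho>_def)
  moreover have "bij_betw \<rho> (S - A) (S - B)"
    using g by (rule bij_betw_cong[THEN iffD1, rotated]) (simp add: \<rho>_def)
  ultimately have "bij_betw \<rho> (A \<union> (S - A)) (B \<union> (S - B))"
    by (rule bij_betw_combine) auto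
  then have "bij_betw \<rho> S S" using assms(2,3) by (simp add: Un_absorb1)
  then have "\<rho> permutes S"
    by (rule bij_imp_permutes) (use assms(2) in \<open>auto simp: \<rho>_def\<close>)
  then show ?thesis using that A by (auto simp: bij_betw_def)
qed

lemma bij_permutes_interval:
  fixes f :: "int \<Rightarrow> int"
  assumes "inj f" "\<And>j. 0 \<le> j \<Longrightarrow> j \<le> L \<Longrightarrow> 0 \<le> f j \<and> f j \<le> L"
  shows "(\<lambda>j. if j \<in> {0..L} then f j else j) permutes {0..L}"
proof (rule bij_imp_permutes)
  let ?g = "\<lambda>j. if j \<in> {0..L} then f j else j"
  have "inj_on ?g {0..L}" using assms(1) by (auto simp: inj_on_def)
  moreover have "?g ` {0..L} \<subseteq> {0..L}" using assms(2) by auto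
  ultimately show "bij_betw ?g {0..L} {0..L}"
    using endo_inj_surj[of "{0..L}" ?g] by (simp add: bij_betw_def)
qed auto

lemma not_power2_dvd_small:
  fixes d :: int
  assumes "d \<noteq> 0" "\<bar>d\<bar> < 2 ^ n"
  shows "\<not> 2 ^ n dvd d"
  using assms zdvd_imp_le[of "2 ^ n" "\<bar>d\<bar>"] by auto

text \<open>The positions \<open>b + K\<close> are the cuts, half way between two centers. Around every cut the family
  acts in the same way, so a permutation \<open>\<rho>\<close> of the levels near the cuts followed by a shift undoes all
  crossings. What remains permutes the blocks between consecutive cuts and only sees
  the letter at the center of the block.\<close>

lemma realized_of_local:
  assumes eq: "equivariant \<phi>" and bij: "\<And>\<omega>. \<omega> \<in> Omega \<Longrightarrow> bij (\<phi> \<omega>)" and K: "K \<ge> 0"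
    and bound: "\<And>\<omega> i. \<omega> \<in> Omega \<Longrightarrow> \<bar>\<phi> \<omega> i - i\<bar> \<le> K"
    and local: "\<And>\<omega> \<eta> i k. \<omega> \<in> Omega \<Longrightarrow> \<eta> \<in> Omega \<Longrightarrow> (\<And>j. \<bar>j\<bar> \<le> K \<Longrightarrow> \<omega> (i + j) = \<eta> (k + j))
      \<Longrightarrow> \<phi> \<omega> i - i = \<phi> \<eta> k - k"
  shows "realized \<phi>"
proof (cases "Omega = {}")
  case True
  then show ?thesis by (intro realized_cong[OF realized_id]) simp
next
  case False
  then obtain \<omega>\<^sub>0 where \<omega>\<^sub>0: "\<omega>\<^sub>0 \<in> Omega" by blast
  \<comment> \<open>Windows of radius \<open>K\<close> around points that interact with a cut must
    avoid the centers on both sides, at distance \<open>h\<close>. This asks for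
    \<open>h > 3 * K\<close>, and the choice leaves some room.\<close>
  define n where "n = nat (4 * K) + 2"
  define h where "h = (2 :: int) ^ (n - 1)"
  have n: "n \<ge> 2" and N: "2 ^ n = 2 * h"
    by (simp_all add: n_def h_def)
  have h: "h > 4 * K + 1"
  proof -
    have "int (nat (4 * K) + 1) < 2 ^ (nat (4 * K) + 1)" by (rule of_nat_less_two_power)
    then show ?thesis using K by (simp add: h_def n_def)
  qed
  obtain p\<^sub>0 where p\<^sub>0: "center n \<omega>\<^sub>0 p\<^sub>0" using center_exists[OF \<omega>\<^sub>0] .
  \<comment> \<open>A block of \<open>2 * K + 1\<close> positions starts at \<open>b\<close>; its
    middle \<open>b + K\<close> is the cut, at distance \<open>h\<close> to the right of a
    center.\<close>
  define c where "c \<omega> b = center n \<omega> (b + (K - h))" for \<omega> b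
  have c: "center n \<omega> p \<Longrightarrow> c \<omega> (p + h - K)" for \<omega> p by (simp add: c_def)
  have spc: "spaced (2 * K) (c \<omega>)" if "\<omega> \<in> Omega" for \<omega>
    using spaced_shift[OF spaced_center[OF that, of "2 * K" n], of "K - h"] h N K by (simp add: c_def[abs_def])

  \<comment> \<open>All cuts look like the one at \<open>p\<^sub>0 + h\<close>, so one function
    describes the motion near every cut. Only levels from \<open>- K\<close> to \<open>3 * K\<close>
    can land in the block.\<close>
  define \<tau> where "\<tau> t = \<phi> \<omega>\<^sub>0 (p\<^sub>0 + h - K + t) - (p\<^sub>0 + h - K)" for t
  have \<tau>: "\<phi> \<omega> (b + t) = b + \<tau> t" if "\<omega> \<in> Omega" "c \<omega> b" "- K \<le> t" "t \<le> 3 * K" for \<omega> b t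
  proof -
    have "\<phi> \<omega> (b + t) - (b + t) = \<phi> \<omega>\<^sub>0 (p\<^sub>0 + h - K + t) - (p\<^sub>0 + h - K + t)"
    proof (rule local[OF that(1) \<omega>\<^sub>0])
      fix j assume j: "\<bar>j\<bar> \<le> K"
      let ?d = "h - K + t + j"
      have "\<not> 2 ^ n dvd ?d" using j that(3,4) h N K by (intro not_power2_dvd_small) auto
      from center_apply[OF _ p\<^sub>0 this, of \<omega> "b + K - h"] that(2)
      show "\<omega> (b + t + j) = \<omega>\<^sub>0 (p\<^sub>0 + h - K + t + j)" by (simp add: c_def algebra_simps)
    qed
    then show ?thesis by (simp add: \<tau>_def)
  qed
  \<comment> \<open>The levels of the cut block that are reached from the cut or from its left. The
    identity would give the \<open>K + 1\<close> levels up to the cut, so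
    \<open>card D - (K + 1)\<close> is the net number of points carried to the right.\<close>
  define D where "D = {u \<in> {0..2 * K}. \<exists>t. - K \<le> t \<and> t \<le> K \<and> \<tau> t = u}"
  define e where "e = int (card D)"
  have D: "D \<subseteq> {0..2 * K}" by (auto simp: D_def)
  have "card D \<le> card {0..2 * K}" using D by (intro card_mono) auto
  then have e: "0 \<le> e" "e \<le> 2 * K + 1" using K by (auto simp: e_def)
  obtain \<rho> where \<rho>: "\<rho> permutes {0..2 * K}" "\<rho> ` D = {0..<e}"
    by (rule permutes_onto[of "{0..2 * K}" D "{0..<e}"]) (use D e in \<open>auto simp: e_def\<close>)
  define g where "g \<omega> = block_perm (2 * K) (c \<omega>) (\<lambda>_. \<rho>)" for \<omega>
  define g' where "g' \<omega> = block_perm (2 * K) (c \<omega>) (\<lambda>_. inv_into UNIV \<rho>)" for \<omega>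
  have inv_\<rho>: "inv_into UNIV \<rho> permutes {0..2 * K}" using \<rho>(1) by (rule permutes_inv)
  have Rg': "realized g'"
    using realized_block_letters[OF n, of "2 * K" "\<lambda>_. inv_into UNIV \<rho>" "K - h"] inv_\<rho> h N K
    by (simp add: g'_def[abs_def] c_def[abs_def])
  have g'g: "g' \<omega> \<circ> g \<omega> = id" "g \<omega> \<circ> g' \<omega> = id" if "\<omega> \<in> Omega" for \<omega>
    using block_perm_comp[OF spc[OF that], of "\<lambda>_. \<rho>" "\<lambda>_. inv_into UNIV \<rho>"] block_perm_comp[OF spc[OF that], of "\<lambda>_. inv_into UNIV \<rho>" "\<lambda>_. \<rho>"]
      \<rho>(1) inv_\<rho> block_perm_id[OF spc[OF that]]
    by (simp_all add: g_def g'_def permutes_inv_o)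

  \<comment> \<open>\<open>\<rho>\<close> packs \<open>D\<close> into the lowest levels, so the
    images of the points up to the cut lie exactly below \<open>b + e\<close>; the shift moves this
    boundary back to the cut \<open>b + K\<close>.\<close>
  define \<psi> where "\<psi> \<omega> i = g \<omega> (\<phi> \<omega> i) + (K + 1 - e)" for \<omega> i
  have cut: "\<psi> \<omega> i \<le> p + h \<longleftrightarrow> i \<le> p + h" if \<omega>: "\<omega> \<in> Omega" and p: "center n \<omega> p" for \<omega> i p
  proof -
    define b where "b = p + h - K"
    have b: "c \<omega> b" using c[OF p] by (simp add: b_def)
    define u where "u = \<phi> \<omega> i - b"
    have near: "\<bar>b + u - i\<bar> \<le> K" using bound[OF \<omega>, of i] by (simp add: u_def)
    have "g \<omega> (b + u) < b + e \<longleftrightarrow> i \<le> b + K"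
    proof -
      \<comment> \<open>Outside the cut block the bound \<open>K\<close> already decides the side;
        inside, membership in \<open>D\<close> does, by injectivity of
        \<open>\<phi> \<omega>\<close>.\<close>
      consider "u < 0" | "u > 2 * K" | "0 \<le> u" "u \<le> 2 * K" by linarith
      then show ?thesis
      proof cases
        case 1
        then have "g \<omega> (b + u) < b"
          unfolding g_def by (intro block_perm_preserves_order(1)[OF spc[OF \<omega>] \<rho>(1) b]) simp
        then show ?thesis using 1 near e by linarith
      next
        case 2
        then have "b + 2 * K < g \<omega> (b + u)"
          unfolding g_def by (intro block_perm_preserves_order(2)[OF spc[OF \<omega>] \<rho>(1) b]) simp
        then show ?thesis using 2 near e by linarith
      next
        case 3
        define t where "t = i - b"
        have t: "- K \<le> t" "t \<le> 3 * K" using near 3 by (auto simp: t_def)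
        have u: "u = \<tau> t" using \<tau>[OF \<omega> b t] by (simp add: u_def t_def)
        have "0 \<le> \<rho> u" using permutes_in_image[OF \<rho>(1), of u] 3 by simp
        then have "\<rho> u < e \<longleftrightarrow> \<rho> u \<in> \<rho> ` D" by (simp add: \<rho>(2))
        also have "\<dots> \<longleftrightarrow> u \<in> D" using permutes_inj[OF \<rho>(1)] by (simp add: inj_image_mem_iff)
        also have "\<dots> \<longleftrightarrow> t \<le> K"
        proof
          assume "u \<in> D"
          then obtain t' where t': "- K \<le> t'" "t' \<le> K" "\<tau> t' = \<tau> t" using u by (auto simp: D_def)
          then have "\<phi> \<omega> (b + t') = \<phi> \<omega> (b + t)"
            using \<tau>[OF \<omega> b, of t'] \<tau>[OF \<omega> b t] K by simp
          then have "t' = t" using bij_is_inj[OF bij[OF \<omega>]] by (simp add: inj_eq)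
          then show "t \<le> K" using t' by simp
        next
          assume "t \<le> K"
          moreover have "u \<in> {0..2 * K}" using 3 by simp
          ultimately show "u \<in> D" unfolding D_def using t(1) u by blast
        qed
        finally have "\<rho> u < e \<longleftrightarrow> t \<le> K" .
        moreover have "g \<omega> (b + u) = b + \<rho> u"
          unfolding g_def by (rule block_perm_in[OF spc[OF \<omega>] b 3])
        ultimately show ?thesis by (auto simp: t_def)
      qed
    qed
    then show ?thesis by (auto simp: \<psi>_def u_def b_def)
  qed
  \<comment> \<open>The block around \<open>p\<close> lies between its own cut and that of the
    previous center \<open>p - 2 ^ n\<close>.\<close>
  have block: "p - h + 1 \<le> \<psi> \<omega> i \<and> \<psi> \<omega> i \<le> p + h \<longleftrightarrow> p - h + 1 \<le> i \<and> i \<le> p + h"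
    if \<omega>: "\<omega> \<in> Omega" and p: "center n \<omega> p" for \<omega> i p
    using cut[OF \<omega> p, of i] cut[OF \<omega> center_shift_multiple(2)[OF p], of i] N by auto
  have inj_\<psi>: "inj (\<psi> \<omega>)" if "\<omega> \<in> Omega" for \<omega>
  proof -
    have inj_g: "inj (g \<omega>)" using g'g[OF that] by (metis inj_on_id inj_on_imageI2)
    show ?thesis
    proof (rule injI)
      fix i j assume "\<psi> \<omega> i = \<psi> \<omega> j"
      then have "g \<omega> (\<phi> \<omega> i) = g \<omega> (\<phi> \<omega> j)" by (simp add: \<psi>_def)
      then show "i = j" using injD[OF inj_g] injD[OF bij_is_inj[OF bij[OF that]]] by blast
    qed
  qed
  \<comment> \<open>The positions read have distance below \<open>2 ^ n\<close> from
    \<open>p\<close>, so \<open>p\<close> is the only center among them and its letter is all that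
    can differ.\<close>
  have same: "\<psi> \<omega> (p + d) - p = \<psi> \<eta> (q + d) - q"
    if \<omega>: "\<omega> \<in> Omega" "\<eta> \<in> Omega" and p: "center n \<omega> p" "center n \<eta> q" and letter: "\<omega> p = \<eta> q"
      and d: "- h < d" "d \<le> h" for \<omega> \<eta> p q d
  proof -
    have "\<phi> \<omega> (p + d) - (p + d) = \<phi> \<eta> (q + d) - (q + d)"
    proof (rule local[OF \<omega>])
      fix j assume j: "\<bar>j\<bar> \<le> K"
      have "\<omega> (p + (d + j)) = \<eta> (q + (d + j))"
      proof (cases "d + j = 0")
        case True
        then show ?thesis using letter by simp
      next
        case False
        then have "\<not> 2 ^ n dvd d + j"
          using j d h N K by (intro not_power2_dvd_small) auto
        then show ?thesis by (rule center_apply[OF p])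
      qed
      then show "\<omega> (p + d + j) = \<eta> (q + d + j)" by (simp add: add.assoc)
    qed
    then have \<phi>: "\<phi> \<eta> (q + d) = \<phi> \<omega> (p + d) + (q - p)" by simp
    have "c \<omega> b \<longleftrightarrow> c \<eta> (b + (q - p))" for b
    proof -
      have "b + (q - p) + (K - h) - q = b + (K - h) - p" by simp
      then show ?thesis unfolding c_def center_iff[OF \<omega>(1) p(1)] center_iff[OF \<omega>(2) p(2)] by metis
    qed
    then have "g \<eta> (\<phi> \<omega> (p + d) + (q - p)) = g \<omega> (\<phi> \<omega> (p + d)) + (q - p)"
      unfolding g_def by (intro block_perm_shift spc \<omega>) simp_all
    then show ?thesis by (simp add: \<psi>_def \<phi>)
  qed
  have "\<exists>s. s permutes {0..2 * h - 1} \<and> (\<forall>\<omega>\<in>Omega. \<forall>p. center n \<omega> p \<longrightarrow> \<omega> p = x \<longrightarrow>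
      (\<forall>j\<in>{0..2 * h - 1}. \<psi> \<omega> (p - h + 1 + j) = p - h + 1 + s j))" for x
  proof (cases "\<exists>\<eta>\<in>Omega. \<exists>q. center n \<eta> q \<and> \<eta> q = x")
    case False
    \<comment> \<open>Letters found at no center, such as \<open>LA\<close>, get the
      identity.\<close>
    then show ?thesis by (intro exI[of _ id]) (auto simp: permutes_id)
  next
    case True
    then obtain \<eta> q where \<eta>: "\<eta> \<in> Omega" "center n \<eta> q" "\<eta> q = x" by blast
    define f where "f j = \<psi> \<eta> (q - h + 1 + j) - (q - h + 1)" for j
    have "inj f"
    proof (rule injI)
      fix i j assume "f i = f j"
      then have "\<psi> \<eta> (q - h + 1 + i) = \<psi> \<eta> (q - h + 1 + j)" by (simp add: f_def)
      then show "i = j" using injD[OF inj_\<psi>[OF \<eta>(1)]] by fastforce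
    qed
    moreover have "0 \<le> f j \<and> f j \<le> 2 * h - 1" if "0 \<le> j" "j \<le> 2 * h - 1" for j
      using block[OF \<eta>(1,2), of "q - h + 1 + j"] that by (auto simp: f_def)
    ultimately have "(\<lambda>j. if j \<in> {0..2 * h - 1} then f j else j) permutes {0..2 * h - 1}"
      by (rule bij_permutes_interval)
    moreover have "\<psi> \<omega> (p - h + 1 + j) = p - h + 1 + f j"
      if "\<omega> \<in> Omega" "center n \<omega> p" "\<omega> p = x" "j \<in> {0..2 * h - 1}" for \<omega> p j
      using same[OF that(1) \<eta>(1) that(2) \<eta>(2), of "1 - h + j"] that(3,4) \<eta>(3)
      by (simp add: f_def algebra_simps)
    ultimately show ?thesis by (intro exI[of _ "\<lambda>j. if j \<in> {0..2 * h - 1} then f j else j"]) simp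
  qed
  then obtain s where s: "\<And>x. s x permutes {0..2 * h - 1}"
    "\<And>\<omega> p j. \<omega> \<in> Omega \<Longrightarrow> center n \<omega> p \<Longrightarrow> j \<in> {0..2 * h - 1} \<Longrightarrow>
      \<psi> \<omega> (p - h + 1 + j) = p - h + 1 + s (\<omega> p) j"
    by metis
  have R\<psi>: "realized \<psi>"
  proof (rule realized_cong)
    show "realized (\<lambda>\<omega>. block_perm (2 * h - 1) (\<lambda>b. center n \<omega> (b + (h - 1))) (\<lambda>b. s (\<omega> (b + (h - 1)))))"
      by (rule realized_block_letters[OF n]) (use s(1) N in simp_all)
    fix \<omega> assume \<omega>: "\<omega> \<in> Omega"
    have "\<psi> \<omega> = block_perm (2 * h - 1) (\<lambda>b. center n \<omega> (b + (h - 1))) (\<lambda>b. s (\<omega> (b + (h - 1))))"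
    proof (rule block_perm_eqI)
      show "spaced (2 * h - 1) (\<lambda>b. center n \<omega> (b + (h - 1)))"
        by (intro spaced_shift spaced_center[OF \<omega>]) (simp add: N)
      show "\<psi> \<omega> (b + j) = b + s (\<omega> (b + (h - 1))) j"
        if "center n \<omega> (b + (h - 1))" "0 \<le> j" "j \<le> 2 * h - 1" for b j
        using s(2)[OF \<omega> that(1), of j] that(2,3) by simp
      \<comment> \<open>The blocks have length \<open>2 * h = 2 ^ n\<close> and tile the line, so
        this case is contradictory: the block containing \<open>i\<close> starts at
        \<open>i - r\<close>.\<close>
      fix i assume out: "\<And>b. center n \<omega> (b + (h - 1)) \<Longrightarrow> b \<le> i \<Longrightarrow> i \<le> b + (2 * h - 1) \<Longrightarrow> False"
      obtain p where p: "center n \<omega> p" using center_exists[OF \<omega>] .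
      define r where "r = (i - p + h - 1) mod (2 * h)"
      have "h > 0" using h K by linarith
      then have r: "0 \<le> r" "r < 2 * h" by (simp_all add: r_def)
      have "center n \<omega> (i - r + (h - 1))"
      proof (rule center_shift[OF p])
        have "2 * h dvd (i - p + h - 1) - r" unfolding r_def by (rule dvd_minus_mod)
        then show "2 ^ n dvd i - r + (h - 1) - p" by (simp add: N algebra_simps)
      qed
      then have False using out[of "i - r"] r by simp
      then show "\<psi> \<omega> i = i" ..
    qed
    then show "block_perm (2 * h - 1) (\<lambda>b. center n \<omega> (b + (h - 1))) (\<lambda>b. s (\<omega> (b + (h - 1)))) = \<psi> \<omega>" ..
  qed
  show ?thesis
  proof (rule realized_cong[OF realized_comp[OF realized_comp[OF Rg' realized_shift[of "- (K + 1 - e)"]] R\<psi>]])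
    fix \<omega> assume "\<omega> \<in> Omega"
    then have "g' \<omega> (g \<omega> i) = i" for i using g'g(1) by (metis comp_apply id_apply)
    then show "g' \<omega> \<circ> (\<lambda>i. i + - (K + 1 - e)) \<circ> \<psi> \<omega> = \<phi> \<omega>"
      by (auto simp: \<psi>_def fun_eq_iff)
  qed
qed

section \<open>From cocycles to the generated group\<close>

lemma full_group_subset_generate:
  assumes "f \<in> full_group_carrier Omega_top Shift"
  shows "f \<in> generate (BijGroup Omega) gens"
proof -
  from assms obtain \<nu> K0 where f: "f \<in> Bij Omega" "windowed K0 \<nu>"
    "\<And>\<omega>. \<omega> \<in> Omega \<Longrightarrow> f \<omega> = translate (\<nu> \<omega>) \<omega>"
    unfolding mem_full_group_carrier_iff by blast
  obtain K where K: "K \<ge> 0" "windowed K \<nu>" "\<And>\<omega>. \<omega> \<in> Omega \<Longrightarrow> \<bar>\<nu> \<omega>\<bar> \<le> K"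
    using windowed_bounded[OF f(2)] by blast
  \<comment> \<open>The action of \<open>f\<close> on the positions of an orbit. By aperiodicity
    positions correspond bijectively to points of the orbit, so bijectivity passes from
    \<open>f\<close> to \<open>\<phi> \<omega>\<close>.\<close>
  define \<phi> where "\<phi> \<omega> i = i + \<nu> (translate i \<omega>)" for \<omega> i
  have f_\<phi>: "f (translate i \<omega>) = translate (\<phi> \<omega> i) \<omega>" if "\<omega> \<in> Omega" for \<omega> i
    using f(3)[of "translate i \<omega>"] that by (simp add: \<phi>_def add.commute)
  have bij: "bij (\<phi> \<omega>)" if \<omega>: "\<omega> \<in> Omega" for \<omega>
  proof (rule bijI)
    show "inj (\<phi> \<omega>)"
    proof (rule injI)
      fix i j assume "\<phi> \<omega> i = \<phi> \<omega> j"
      then have "f (translate i \<omega>) = f (translate j \<omega>)" using f_\<phi>[OF \<omega>] by metis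
      then have "translate i \<omega> = translate j \<omega>"
        using f(1) \<omega> by (auto simp: Bij_def bij_betw_def inj_on_def)
      then show "i = j" by (rule translate_aperiodic[OF \<omega>])
    qed
    show "surj (\<phi> \<omega>)"
      unfolding surj_def
    proof
      fix k
      have "translate k \<omega> \<in> f ` Omega"
        using f(1) \<omega> by (simp add: Bij_def bij_betw_def)
      then obtain \<eta> where \<eta>: "\<eta> \<in> Omega" "translate k \<omega> = f \<eta>" by blast
      have "\<eta> = translate (- \<nu> \<eta>) (translate k \<omega>)" using \<eta> f(3) by simp
      then have "\<eta> = translate (k - \<nu> \<eta>) \<omega>" by (simp add: add.commute)
      then have "translate k \<omega> = translate (\<phi> \<omega> (k - \<nu> \<eta>)) \<omega>"
        using \<eta>(2) f_\<phi>[OF \<omega>] by metis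
      then show "\<exists>i. k = \<phi> \<omega> i" using translate_aperiodic[OF \<omega>] by blast
    qed
  qed
  have loc: "\<phi> \<omega> i - i = \<phi> \<eta> k - k"
    if "\<omega> \<in> Omega" "\<eta> \<in> Omega" "\<And>j. \<bar>j\<bar> \<le> K \<Longrightarrow> \<omega> (i + j) = \<eta> (k + j)" for \<omega> \<eta> i k
  proof -
    have "\<nu> (translate i \<omega>) = \<nu> (translate k \<eta>)"
      by (rule windowedD[OF K(2)]) (use that in \<open>simp_all add: add.commute\<close>)
    then show ?thesis by (simp add: \<phi>_def)
  qed
  have eq: "equivariant \<phi>" by (simp add: equivariant_def \<phi>_def algebra_simps)
  have bound: "\<bar>\<phi> \<omega> i - i\<bar> \<le> K" if "\<omega> \<in> Omega" for \<omega> i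
    using K(3)[of "translate i \<omega>"] that by (simp add: \<phi>_def)
  have "realized \<phi>"
    by (rule realized_of_local) (fact eq bij K(1) bound loc)+
  moreover have "orbit_map \<phi> = f"
  proof
    fix \<omega> show "orbit_map \<phi> \<omega> = f \<omega>"
      using f Bij_imp_extensional[OF f(1)]
      by (cases "\<omega> \<in> Omega") (auto simp: orbit_map_def \<phi>_def extensional_def)
  qed
  ultimately show ?thesis by (simp add: realized_def)
qed

theorem theorem1p10:
  shows "generate (topological_full_group Omega_top Shift)
           {Shift, delta (cylinder [] [LB]), delta (cylinder [] [LD]),
            delta (cylinder [] [LA, LC, LA, LC, LA, LC])}
         = carrier (topological_full_group Omega_top Shift)"
proof -
  interpret group "BijGroup Omega" by (rule group_BijGroup)
  \<comment> \<open>The full group is a subgroup of \<open>BijGroup Omega\<close>, so generating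
    inside either gives the same set.\<close>
  have "generate (topological_full_group Omega_top Shift) gens = generate (BijGroup Omega) gens"
    unfolding topological_full_group_def topspace_Omega_top
    by (rule generate_consistent[OF gens_subset subgroup_full_group_carrier])
  moreover have "generate (BijGroup Omega) gens \<subseteq> full_group_carrier Omega_top Shift"
    by (rule generate_subgroup_incl[OF gens_subset subgroup_full_group_carrier])
  ultimately show ?thesis
    using full_group_subset_generate by (auto simp: topological_full_group_def gens_def)
qed

end
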